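(* Let $F$ be an Orlicz function satisfying the $\Delta_2$-condition. If the Orlicz space $L_F[0,1]$ is elastic, then its Boyd indices $p_F$ and $q_F$ coincide.
   Context: **Orlicz spaces.** An Orlicz function is a continuous strictly increasing convex function $F:[0,\infty)\to[0,\infty)$ with $F(0)=0$. It satisfies the $\Delta_2$-condition if there is a constant $\Delta$ with $F(2x)\le\Delta F(x)$ for all $x\ge0$. $L_F[0,1]$ is the space of measurable $f$ on $[0,1]$ (Lebesgue measure) with $\|f\|_{L_F}=\inf\{\alpha>0:\int_0^1F(\alpha^{-1}|f(t)|)\,dt\le1\}<\infty$. **Boyd indices.** For $X=L_F[0,1]$ and $a>0$ let $D_af(t)=f(t/a)$, where $f$ is regarded as vanishing outside $[0,1]$. Then $p_F=\lim_{a\to\infty}\frac{\log a}{\log\|D_a\|_X}$ and $q_F=\lim_{a\to0}\frac{\log a}{\log\|D_a\|_X}$. **Elastic spaces.** For $X=L_F[0,1]$, let $\mathbb Z_-=\{n\in\mathbb Z:n<0\}$, $e_n=\chi_{[2^n,2^{n+1})}$ for $n\in\mathbb Z_-$, and let $E_X$ be the space of real sequences $x=(x(n))_{n\in\mathbb Z_-}$ with $\|x\|_{E_X}=\|\sum_{n\in\mathbb Z_-}x(n)e_n\|_X<\infty$. For sets of integers write $A<B$ if $a<b$ for all $a\in A,b\in B$. If $I$ is an interval of $\mathbb Z$, a pair $(x_n,y_n)_{n\in I}$ of sequences of finitely supported elements of $E_X$ is interlaced if $\operatorname{supp}x_n<\operatorname{supp}y_n$ for $n\in I$ and $\operatorname{supp}y_n<\operatorname{supp}x_{n+1}$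 whenever $n,n+1\in I$. A sequence space $E$ has the right-shift property (RSP) if there is a constant $C$ such that for every interlaced pair with $\|y_n\|_E\le\|x_n\|_E=1$ $(n\in I)$ and every finitely nonzero scalar sequence $(\alpha_n)_{n\in I}$, $\|\sum_n\alpha_ny_n\|_E\le C\|\sum_n\alpha_nx_n\|_E$. It has the left-shift property (LSP) if there is a constant $C'$ such that for every interlaced pair with $\|x_n\|_E\le\|y_n\|_E=1$ and every finitely nonzero $(\alpha_n)$, $\|\sum_n\alpha_nx_n\|_E\le C'\|\sum_n\alpha_ny_n\|_E$. $X$ is elastic if $E_X$ has both (RSP) and (LSP). *)

theory Defs
  imports "HOL-Analysis.Analysis"
begin

(* Only the values of F on [0,\<infinity>) matter; F \<ge> 0 there follows from
   monotonicity and F 0 = 0. *)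
definition orlicz_function :: "(real \<Rightarrow> real) \<Rightarrow> bool" where
  "orlicz_function F \<longleftrightarrow>
     continuous_on {0..} F \<and> strict_mono_on {0..} F \<and> convex_on {0..} F \<and> F 0 = 0"

definition delta2_condition :: "(real \<Rightarrow> real) \<Rightarrow> bool" where
  "delta2_condition F \<longleftrightarrow> (\<exists>\<Delta>. \<forall>x\<ge>0. F (2 * x) \<le> \<Delta> * F x)"

(* Luxemburg norm, with value \<infinity> if no \<alpha> is admissible (Inf {} = \<infinity> in ennreal).
   Elements of L_F[0,1] are represented by functions on the whole line whose values
   outside [0,1] are ignored, without identifying functions that agree a.e. *)
definition orlicz_norm :: "(real \<Rightarrow> real) \<Rightarrow> (real \<Rightarrow> real) \<Rightarrow> ennreal" where
  "orlicz_norm F f =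
     (INF \<alpha>\<in>{\<alpha>::real. \<alpha> > 0 \<and> (\<integral>\<^sup>+t. ennreal (F (\<bar>f t\<bar> / \<alpha>)) \<partial>lebesgue_on {0..1}) \<le> 1}. ennreal \<alpha>)"

definition orlicz_space :: "(real \<Rightarrow> real) \<Rightarrow> (real \<Rightarrow> real) set" where
  "orlicz_space F = {f \<in> borel_measurable (lebesgue_on {0..1}). orlicz_norm F f < \<infinity>}"

definition dilation :: "real \<Rightarrow> (real \<Rightarrow> real) \<Rightarrow> real \<Rightarrow> real" where
  "dilation a f t = (if t / a \<in> {0..1} then f (t / a) else 0)"

(* Operator norm of the dilation on L_F[0,1]. It is at most max 1 a for an Orlicz function F,
   so passing from ennreal to real loses nothing. *)
definition dilation_norm :: "(real \<Rightarrow> real) \<Rightarrow> real \<Rightarrow> real" where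
  "dilation_norm F a =
     enn2real (SUP f\<in>{f \<in> orlicz_space F. orlicz_norm F f \<le> 1}. orlicz_norm F (dilation a f))"

(* The Boyd indices p and q, given as relations so that existence of the limit is part of
   the notion. Under the Delta_2-condition both are finite, and the denominators are nonzero
   for all large, respectively all small, a. *)
definition has_lower_boyd_index :: "(real \<Rightarrow> real) \<Rightarrow> real \<Rightarrow> bool" where
  "has_lower_boyd_index F p \<longleftrightarrow> ((\<lambda>a. ln a / ln (dilation_norm F a)) \<longlongrightarrow> p) at_top"

definition has_upper_boyd_index :: "(real \<Rightarrow> real) \<Rightarrow> real \<Rightarrow> bool" where
  "has_upper_boyd_index F q \<longleftrightarrow> ((\<lambda>a. ln a / ln (dilation_norm F a)) \<longlongrightarrow> q) (at_right 0)"

(* Sequences indexed by the negative integers are functions on int vanishing on {0..}. *)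
definition dyadic_norm :: "(real \<Rightarrow> real) \<Rightarrow> (int \<Rightarrow> real) \<Rightarrow> ennreal" where
  "dyadic_norm F x =
     orlicz_norm F (\<lambda>t. \<Sum>\<^sub>\<infinity>n\<in>{..<0}. x n * indicator {2 powi n..<2 powi (n + 1)} t)"

definition dyadic_space :: "(real \<Rightarrow> real) \<Rightarrow> (int \<Rightarrow> real) set" where
  "dyadic_space F = {x. (\<forall>n\<ge>0. x n = 0) \<and> dyadic_norm F x < \<infinity>}"

definition seq_supp :: "(int \<Rightarrow> real) \<Rightarrow> int set" where
  "seq_supp x = {k. x k \<noteq> 0}"

definition set_less :: "int set \<Rightarrow> int set \<Rightarrow> bool" where
  "set_less A B \<longleftrightarrow> (\<forall>a\<in>A. \<forall>b\<in>B. a < b)"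

definition int_interval :: "int set \<Rightarrow> bool" where
  "int_interval I \<longleftrightarrow> (\<forall>i\<in>I. \<forall>k\<in>I. \<forall>j. i \<le> j \<and> j \<le> k \<longrightarrow> j \<in> I)"

(* The members of an interlaced pair are taken to be nonzero: set_less holds vacuously
   for the empty set, so a zero member would break the chain of supports
   x_n < y_n < x_(n+1) < ..., and for instance y_0 = 0, x_1 = - x_0, y_1 \<noteq> 0
   would then refute the right-shift property of every nontrivial space. *)
definition interlaced ::
  "(int \<Rightarrow> real) set \<Rightarrow> int set \<Rightarrow> (int \<Rightarrow> int \<Rightarrow> real) \<Rightarrow> (int \<Rightarrow> int \<Rightarrow> real) \<Rightarrow> bool" where
  "interlaced E I x y \<longleftrightarrow>
     (\<forall>n\<in>I. x n \<in> E \<and> finite (seq_supp (x n)) \<and> seq_supp (x n) \<noteq> {} \<and>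
             y n \<in> E \<and> finite (seq_supp (y n)) \<and> seq_supp (y n) \<noteq> {}) \<and>
     (\<forall>n\<in>I. set_less (seq_supp (x n)) (seq_supp (y n))) \<and>
     (\<forall>n. n \<in> I \<and> n + 1 \<in> I \<longrightarrow> set_less (seq_supp (y n)) (seq_supp (x (n + 1))))"

definition lin_comb :: "int set \<Rightarrow> (int \<Rightarrow> real) \<Rightarrow> (int \<Rightarrow> int \<Rightarrow> real) \<Rightarrow> int \<Rightarrow> real" where
  "lin_comb I \<alpha> x k = (\<Sum>n\<in>{n\<in>I. \<alpha> n \<noteq> 0}. \<alpha> n * x n k)"

definition right_shift_property :: "(int \<Rightarrow> real) set \<Rightarrow> ((int \<Rightarrow> real) \<Rightarrow> ennreal) \<Rightarrow> bool" where
  "right_shift_property E N \<longleftrightarrow>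
     (\<exists>C::real. \<forall>I x y \<alpha>.
        int_interval I \<and> interlaced E I x y \<and>
        (\<forall>n\<in>I. N (y n) \<le> N (x n) \<and> N (x n) = 1) \<and> finite {n\<in>I. \<alpha> n \<noteq> 0} \<longrightarrow>
        N (lin_comb I \<alpha> y) \<le> ennreal C * N (lin_comb I \<alpha> x))"

definition left_shift_property :: "(int \<Rightarrow> real) set \<Rightarrow> ((int \<Rightarrow> real) \<Rightarrow> ennreal) \<Rightarrow> bool" where
  "left_shift_property E N \<longleftrightarrow>
     (\<exists>C::real. \<forall>I x y \<alpha>.
        int_interval I \<and> interlaced E I x y \<and>
        (\<forall>n\<in>I. N (x n) \<le> N (y n) \<and> N (y n) = 1) \<and> finite {n\<in>I. \<alpha> n \<noteq> 0} \<longrightarrow>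
        N (lin_comb I \<alpha> x) \<le> ennreal C * N (lin_comb I \<alpha> y))"

definition elastic :: "(real \<Rightarrow> real) \<Rightarrow> bool" where
  "elastic F \<longleftrightarrow>
     right_shift_property (dyadic_space F) (dyadic_norm F) \<and>
     left_shift_property (dyadic_space F) (dyadic_norm F)"

end

theory Submission
  imports Defs
begin

text \<open>
  Let \<open>b n\<close> be the point with \<open>F (b n) = 2 powi (- n)\<close>, so that \<open>b n\<close> times the
  \<open>n\<close>-th unit vector has norm one in the dyadic sequence space. The right-shift property,
  applied to such vectors only, compares the sums \<open>\<Sum> F (b (s i) * x) / F (b (s i))\<close>
  and \<open>\<Sum> F (b (t i) * x) / F (b (t i))\<close> for interlaced indices \<open>s i < t i\<close>. If a small value
  of \<open>F (b n * x) / F (b n)\<close> recurred for \<open>n \<rightarrow> -\<infinity>\<close>, and a much larger one recurred as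
  well, then interlacing indices of the two kinds would break this comparison. Hence, for each
  fixed \<open>l\<close>, the ratio \<open>F (l t) / F t\<close> is determined for large \<open>t\<close> up to a factor that does
  not depend on \<open>l\<close>. Taking powers of \<open>l\<close>, this factor becomes irrelevant, and \<open>F\<close> grows
  like a power \<open>p\<close> up to arbitrarily small changes of the exponent. The norm of the dilation by
  \<open>a\<close> is then \<open>a powr (1 / p)\<close> up to such changes, both for large and for small \<open>a\<close>.
\<close>

subsection \<open>Orlicz functions\<close>

locale orlicz =
  fixes F :: "real \<Rightarrow> real"
  assumes orlicz: "orlicz_function F"
begin

lemma F_0 [simp]: "F 0 = 0"
  using orlicz by (simp add: orlicz_function_def)

lemma F_less_iff: "0 \<le> x \<Longrightarrow> 0 \<le> y \<Longrightarrow> F x < F y \<longleftrightarrow> x < y"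
  using orlicz strict_mono_on_less[of "{0..}" F x y] by (simp add: orlicz_function_def)

lemma F_le_iff: "0 \<le> x \<Longrightarrow> 0 \<le> y \<Longrightarrow> F x \<le> F y \<longleftrightarrow> x \<le> y"
  using F_less_iff[of y x] by linarith

lemma F_nonneg: "0 \<le> x \<Longrightarrow> 0 \<le> F x"
  using F_le_iff[of 0 x] by simp

lemma F_pos: "0 < x \<Longrightarrow> 0 < F x"
  using F_less_iff[of 0 x] by simp

lemma F_scale_le:
  assumes "0 \<le> c" "c \<le> 1" "0 \<le> x"
  shows "F (c * x) \<le> c * F x"
proof -
  have "convex_on {0..} F" using orlicz by (simp add: orlicz_function_def)
  from convex_onD[OF this, of c 0 x] assms show ?thesis by simp
qed

lemma F_scale_ge:
  assumes "1 \<le> c" "0 \<le> x"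
  shows "c * F x \<le> F (c * x)"
  using F_scale_le[of "1 / c" "c * x"] assms by (simp add: field_simps)

lemma F_surj:
  assumes "0 \<le> y"
  shows "\<exists>x\<ge>0. F x = y"
proof -
  \<comment> \<open>Convexity makes \<open>F\<close> grow at least linearly, so
    \<open>c \<ge> 1\<close> with \<open>y \<le> c * F 1\<close> puts \<open>y\<close> below
    \<open>F c\<close>, within reach of the intermediate value theorem.\<close>
  define c where "c = max 1 (y / F 1)"
  have "y \<le> c * F 1" using F_pos[of 1] by (simp add: c_def max_def field_simps)
  also have "\<dots> \<le> F (c * 1)" using F_scale_ge[of c 1] by (simp add: c_def)
  finally have "y \<le> F c" by simp
  moreover have "continuous_on {0..c} F"
    using orlicz continuous_on_subset[of "{0..}" F "{0..c}"] by (auto simp: orlicz_function_def)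
  moreover have "0 \<le> c" by (simp add: c_def)
  ultimately show ?thesis
    using IVT'[of F 0 y c] assms F_0 by auto
qed

lemma F_surj_pos:
  assumes "0 < y"
  shows "\<exists>x>0. F x = y"
  using F_surj[of y] assms F_0 by (metis less_eq_real_def less_irrefl)

text \<open>Nothing is assumed about \<open>F\<close> on negative arguments, so measurability is
  stated for the truncation \<open>max 0 u\<close>, which is harmless for arguments of the form
  \<open>\<bar>f t\<bar> / \<alpha>\<close>.\<close>

lemma borel_measurable_F [measurable]: "(\<lambda>u. F (max 0 u)) \<in> borel_measurable borel"
proof -
  have "continuous_on {0..} F" using orlicz by (simp add: orlicz_function_def)
  then have "continuous_on UNIV (\<lambda>u. F (max 0 u))"
    by (rule continuous_on_compose2) (auto intro: continuous_intros)
  then show ?thesis by (rule borel_measurable_continuous_onI)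
qed

lemma borel_measurable_F_abs [measurable]:
  assumes [measurable]: "f \<in> borel_measurable M" and "0 < \<alpha>"
  shows "(\<lambda>t. F (\<bar>f t\<bar> / \<alpha>)) \<in> borel_measurable M"
proof -
  have "(\<lambda>t. F (max 0 (\<bar>f t\<bar> / \<alpha>))) \<in> borel_measurable M" by measurable
  then show ?thesis using \<open>0 < \<alpha>\<close> by (simp add: max_def)
qed

subsection \<open>The Luxemburg norm\<close>

abbreviation scaled_modular :: "(real \<Rightarrow> real) \<Rightarrow> real \<Rightarrow> ennreal" where
  "scaled_modular f \<alpha> \<equiv> \<integral>\<^sup>+t. ennreal (F (\<bar>f t\<bar> / \<alpha>)) \<partial>lebesgue_on {0..1}"

lemma orlicz_norm_le: "0 < \<alpha> \<Longrightarrow> scaled_modular f \<alpha> \<le> 1 \<Longrightarrow> orlicz_norm F f \<le> ennreal \<alpha>"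
  unfolding orlicz_norm_def by (rule INF_lower) simp

text \<open>The strict inequality provides an admissible scale below \<open>\<alpha>\<close>, so it
  does not matter whether the infimum is attained; the modular decreases as the scale grows.\<close>

lemma scaled_modular_le_1:
  assumes "orlicz_norm F f < ennreal \<alpha>"
  shows "scaled_modular f \<alpha> \<le> 1"
proof -
  from assms obtain \<beta> where \<beta>: "0 < \<beta>" "scaled_modular f \<beta> \<le> 1" "ennreal \<beta> < ennreal \<alpha>"
    unfolding orlicz_norm_def INF_less_iff by blast
  then have "\<beta> < \<alpha>" by (simp add: ennreal_less_iff)
  have "scaled_modular f \<alpha> \<le> scaled_modular f \<beta>"
    using \<open>0 < \<beta>\<close> \<open>\<beta> < \<alpha>\<close>
    by (intro nn_integral_mono ennreal_leI iffD2[OF F_le_iff]) (auto simp: frac_le)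
  also note \<beta>(2)
  finally show ?thesis .
qed

lemma scaled_modular_indicator:
  assumes S: "S \<in> sets lebesgue" "S \<subseteq> {0..1}" and "emeasure lebesgue S = ennreal r" "0 \<le> r"
    and "0 < \<alpha>"
  shows "scaled_modular (\<lambda>t. c * indicator S t) \<alpha> = ennreal (F (\<bar>c\<bar> / \<alpha>) * r)"
proof -
  have "scaled_modular (\<lambda>t. c * indicator S t) \<alpha>
      = (\<integral>\<^sup>+t. ennreal (F (\<bar>c\<bar> / \<alpha>)) * indicator S t \<partial>lebesgue_on {0..1})"
    by (intro nn_integral_cong) (auto simp: indicator_def)
  also have "\<dots> = ennreal (F (\<bar>c\<bar> / \<alpha>)) * emeasure (lebesgue_on {0..1}) S"
    using S by (intro nn_integral_cmult_indicator) (auto simp: sets_restrict_space image_iff)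
  also have "emeasure (lebesgue_on {0..1}) S = ennreal r"
    using S assms by (subst emeasure_restrict_space) auto
  finally show ?thesis using assms F_nonneg by (simp add: ennreal_mult'')
qed

text \<open>The admissible scales are exactly the positive \<open>\<alpha>\<close> with
  \<open>\<bar>c\<bar> / \<alpha> \<le> w\<close>, since \<open>F w * r = 1\<close>.\<close>

lemma orlicz_norm_indicator:
  assumes S: "S \<in> sets lebesgue" "S \<subseteq> {0..1}" "emeasure lebesgue S = ennreal r" "0 < r"
    and w: "0 < w" "F w = 1 / r"
  shows "orlicz_norm F (\<lambda>t. c * indicator S t) = ennreal (\<bar>c\<bar> / w)"
proof (rule antisym)
  have adm: "scaled_modular (\<lambda>t. c * indicator S t) \<alpha> \<le> 1 \<longleftrightarrow> \<bar>c\<bar> / w \<le> \<alpha>" if "0 < \<alpha>" for \<alpha>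
  proof -
    have "scaled_modular (\<lambda>t. c * indicator S t) \<alpha> \<le> 1 \<longleftrightarrow> F (\<bar>c\<bar> / \<alpha>) * r \<le> 1"
      using scaled_modular_indicator[OF S(1-3) _ that, of c] S(4)
      by (simp add: ennreal_le_1)
    also have "\<dots> \<longleftrightarrow> F (\<bar>c\<bar> / \<alpha>) \<le> F w" using w(2) S(4) by (simp only: pos_le_divide_eq)
    also have "\<dots> \<longleftrightarrow> \<bar>c\<bar> / \<alpha> \<le> w" using w that by (intro F_le_iff) auto
    finally show ?thesis using w that by (simp add: field_simps)
  qed
  show "orlicz_norm F (\<lambda>t. c * indicator S t) \<ge> ennreal (\<bar>c\<bar> / w)"
    unfolding orlicz_norm_def using adm by (intro INF_greatest ennreal_leI) auto
  show "orlicz_norm F (\<lambda>t. c * indicator S t) \<le> ennreal (\<bar>c\<bar> / w)"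
  \<comment> \<open>For \<open>c = 0\<close> the value \<open>\<bar>c\<bar> / w\<close> is zero and
    hence not a permitted scale, so it is approached from above.\<close>
  proof (rule ennreal_le_epsilon)
    fix e :: real assume e: "0 < e"
    then have pos: "0 < \<bar>c\<bar> / w + e" using w by (intro add_nonneg_pos) auto
    then have "orlicz_norm F (\<lambda>t. c * indicator S t) \<le> ennreal (\<bar>c\<bar> / w + e)"
      using e adm[of "\<bar>c\<bar> / w + e"] by (intro orlicz_norm_le) auto
    then show "orlicz_norm F (\<lambda>t. c * indicator S t) \<le> ennreal (\<bar>c\<bar> / w) + ennreal e"
      using w e by (subst ennreal_plus[symmetric]) auto
  qed
qed

subsection \<open>Dilations\<close>

text \<open>The substitution \<open>u = t / a\<close> multiplies the modular by \<open>a\<close>.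
  Where the argument is large, \<open>grow\<close> absorbs this factor into the scale
  \<open>A\<close>; the remaining arguments contribute at most \<open>F u0\<close>. The total
  \<open>1 + F u0\<close> is brought down to 1 by convexity. Since \<open>grow\<close> is restricted
  to large arguments on both sides, it can be fed with asymptotic growth estimates.\<close>

lemma scaled_modular_dilation_le_1:
  assumes a: "0 < a" and A: "0 < A" and u0: "0 < u0"
    and grow: "\<And>w. u0 \<le> w \<Longrightarrow> u0 \<le> A * w \<Longrightarrow> a * F w \<le> F (A * w)"
    and f: "f \<in> borel_measurable (lebesgue_on {0..1})" and f1: "scaled_modular f \<beta> \<le> 1" and \<beta>: "0 < \<beta>"
  shows "scaled_modular (dilation a f) (\<beta> * A * (1 + F u0)) \<le> 1"
proof -
  define B where "B = 1 + F u0"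
  have B: "1 \<le> B" using F_nonneg[of u0] u0 by (simp add: B_def)
  \<comment> \<open>the growth hypothesis may fail for arguments below \<open>M\<close>, where \<open>F\<close> is at most \<open>F M\<close>\<close>
  define M where "M = max u0 (u0 / A)"
  \<comment> \<open>The points \<open>u = t / a\<close> with \<open>t\<close> and \<open>u\<close>
    both in \<open>{0..1}\<close> fill \<open>{0..r}\<close>.\<close>
  define r where "r = min 1 (1 / a)"
  have M0: "0 < M" using u0 by (simp add: M_def)
  have r0: "0 < r" "r \<le> 1" "a * r \<le> 1" using a by (auto simp: r_def min_def field_simps)
  define h where "h u = ennreal (F (\<bar>f u\<bar> / (\<beta> * A))) * indicator {0..r} u" for u
  have [measurable]: "(\<lambda>u. F (\<bar>f u\<bar> / (\<beta> * A))) \<in> borel_measurable (lebesgue_on {0..1})"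
    using borel_measurable_F_abs[OF f, of "\<beta> * A"] \<beta> A by simp
  have "(\<lambda>u. ennreal (F (\<bar>f u\<bar> / (\<beta> * A))) * indicator {0..1} u) \<in> borel_measurable lebesgue"
    by (subst borel_measurable_restrict_space_iff_ennreal[symmetric]) auto
  then have "(\<lambda>u. ennreal (F (\<bar>f u\<bar> / (\<beta> * A))) * indicator {0..1} u * indicator {0..r} u)
      \<in> borel_measurable lebesgue"
    by (rule borel_measurable_times_ennreal) (intro borel_measurable_indicator, simp)
  also have "(\<lambda>u. ennreal (F (\<bar>f u\<bar> / (\<beta> * A))) * indicator {0..1} u * indicator {0..r} u) = h"
    using r0 by (auto simp: h_def indicator_def)
  finally have h [measurable]: "h \<in> borel_measurable lebesgue" .
  \<comment> \<open>The argument \<open>t / a\<close> is written as \<open>0 + 1 / a * t\<close> to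
    match the affine substitution rule used below.\<close>
  have hh: "(\<lambda>t. h (0 + 1 / a * t)) \<in> borel_measurable lebesgue"
    using measurable_compose[OF lebesgue_measurable_scaling[of "1 / a"] h] by simp
  \<comment> \<open>Since \<open>a * r = min a 1\<close>, this is the bound by \<open>F u0\<close>
    for the error term \<open>a * F M\<close> integrated over \<open>{0..r}\<close>. For
    \<open>A < 1\<close> it comes from \<open>grow\<close> at \<open>M\<close> itself, where
    \<open>A * M = u0\<close>.\<close>
  have FM: "min a 1 * F M \<le> F u0"
  proof (cases "1 \<le> A")
    case True
    then have "M = u0" using u0 by (simp add: M_def max_def field_simps)
    then show ?thesis using F_nonneg[of u0] u0 mult_right_mono[of "min a 1" 1 "F u0"] by simp
  next
    case False
    then have "M = u0 / A" using u0 A by (simp add: M_def max_def field_simps)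
    then have "a * F M \<le> F u0" using grow[of M] A by (simp add: M_def)
    moreover have "min a 1 * F M \<le> a * F M" using M0 F_nonneg[of M] by (intro mult_right_mono) auto
    ultimately show ?thesis by linarith
  qed
  have bound: "a * F (A * u) \<le> F (A * (A * u)) + a * F M"
    if "0 \<le> u" for u
  proof (cases "M \<le> A * u")
    case True
    then have "u0 \<le> A * u" "u0 \<le> A * (A * u)" using A by (auto simp: M_def field_simps)
    from grow[OF this] show ?thesis using F_nonneg[of M] M0 a by (smt (verit) mult_nonneg_nonneg)
  next
    case False
    then have "F (A * u) \<le> F M" using that A M0 by (subst F_le_iff) auto
    then have "a * F (A * u) \<le> a * F M" using a by simp
    then show ?thesis using F_nonneg[of "A * (A * u)"] that A by (smt (verit) mult_nonneg_nonneg)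
  qed
  have "(\<integral>\<^sup>+t. h (0 + 1 / a * t) \<partial>lebesgue)
      = ennreal a * (\<integral>\<^sup>+u. h u \<partial>lebesgue)"
    using nn_integral_real_affine_lebesgue[OF h, of "1 / a" 0] a
    by (simp add: mult.assoc[symmetric] ennreal_mult''[symmetric])
  also have "\<dots> = (\<integral>\<^sup>+u. ennreal a * h u \<partial>lebesgue)"
    by (intro nn_integral_cmult[symmetric]) simp
  also have "\<dots> \<le> (\<integral>\<^sup>+u. ennreal (F (\<bar>f u\<bar> / \<beta>)) * indicator {0..1} u
      + ennreal (a * F M) * indicator {0..r} u \<partial>lebesgue)"
  proof (intro nn_integral_mono)
    fix u :: real
    have "ennreal (a * F (\<bar>f u\<bar> / (\<beta> * A)))
        \<le> ennreal (F (\<bar>f u\<bar> / \<beta>)) + ennreal (a * F M)"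
      using bound[of "\<bar>f u\<bar> / (\<beta> * A * A)"] \<beta> A a F_nonneg[of M] F_nonneg[of "\<bar>f u\<bar> / \<beta>"] M0
      by (simp add: ennreal_plus[symmetric] ennreal_leI del: ennreal_plus)
    then show "ennreal a * h u \<le> ennreal (F (\<bar>f u\<bar> / \<beta>)) * indicator {0..1} u
      + ennreal (a * F M) * indicator {0..r} u"
      using r0 a by (auto simp: h_def indicator_def ennreal_mult')
  qed
  also have "\<dots> = (\<integral>\<^sup>+u. ennreal (F (\<bar>f u\<bar> / \<beta>)) * indicator {0..1} u \<partial>lebesgue)
      + (\<integral>\<^sup>+u. ennreal (a * F M) * indicator {0..r} u \<partial>lebesgue)"
    using borel_measurable_F_abs[OF f \<beta>]
    by (intro nn_integral_add)
      (auto simp: borel_measurable_restrict_space_iff_ennreal[symmetric])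
  also have "(\<integral>\<^sup>+u. ennreal (a * F M) * indicator {0..r} u \<partial>lebesgue) = ennreal (a * F M) * ennreal r"
    using r0 by (subst nn_integral_cmult_indicator) auto
  also have "(\<integral>\<^sup>+u. ennreal (F (\<bar>f u\<bar> / \<beta>)) * indicator {0..1} u \<partial>lebesgue) = scaled_modular f \<beta>"
    by (simp add: nn_integral_restrict_space)
  also have "scaled_modular f \<beta> + ennreal (a * F M) * ennreal r \<le> 1 + ennreal (F u0)"
  proof (rule add_mono[OF f1])
    have "a * r = min a 1" using a by (auto simp: r_def min_def field_simps)
    moreover have "a * F M * r = a * r * F M" by simp
    ultimately have "a * F M * r \<le> F u0" using FM by (simp only:)
    then show "ennreal (a * F M) * ennreal r \<le> ennreal (F u0)"
      using r0 by (simp add: ennreal_mult''[symmetric] ennreal_leI)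
  qed
  also have "\<dots> = ennreal B" using u0 F_nonneg by (simp add: B_def)
  finally have le: "(\<integral>\<^sup>+t. h (0 + 1 / a * t) \<partial>lebesgue) \<le> ennreal B" .
  have "scaled_modular (dilation a f) (\<beta> * A * B)
      = (\<integral>\<^sup>+t. ennreal (F (\<bar>dilation a f t\<bar> / (\<beta> * A * B))) * indicator {0..1} t \<partial>lebesgue)"
    by (simp add: nn_integral_restrict_space)
  also have "\<dots> \<le> (\<integral>\<^sup>+t. ennreal (1 / B) * h (0 + 1 / a * t) \<partial>lebesgue)"
  proof (intro nn_integral_mono)
    fix t :: real
    \<comment> \<open>Convexity: enlarging the scale by \<open>B\<close> shrinks the modular at
      least by the factor \<open>1 / B\<close>.\<close>
    have "F (\<bar>dilation a f t\<bar> / (\<beta> * A * B)) \<le> 1 / B * F (\<bar>dilation a f t\<bar> / (\<beta> * A))"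
      using F_scale_le[of "1 / B" "\<bar>dilation a f t\<bar> / (\<beta> * A)"] B A \<beta> by (simp add: ac_simps)
    then have "ennreal (F (\<bar>dilation a f t\<bar> / (\<beta> * A * B)))
          \<le> ennreal (1 / B) * ennreal (F (\<bar>dilation a f t\<bar> / (\<beta> * A)))"
      using B by (subst ennreal_mult'[symmetric]) (auto intro: ennreal_leI)
    moreover have "ennreal (F (\<bar>dilation a f t\<bar> / (\<beta> * A))) \<le> h (0 + 1 / a * t)" if "t \<in> {0..1}"
      using that a by (auto simp: h_def dilation_def indicator_def r_def field_simps)
    ultimately have "ennreal (F (\<bar>dilation a f t\<bar> / (\<beta> * A * B))) \<le> ennreal (1 / B) * h (0 + 1 / a * t)"
      if "t \<in> {0..1}"
      using that by (meson order_trans mult_left_mono zero_le)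
    then show "ennreal (F (\<bar>dilation a f t\<bar> / (\<beta> * A * B))) * indicator {0..1} t
        \<le> ennreal (1 / B) * h (0 + 1 / a * t)"
      by (cases "t \<in> {0..1}") auto
  qed
  also have "\<dots> = ennreal (1 / B) * (\<integral>\<^sup>+t. h (0 + 1 / a * t) \<partial>lebesgue)"
    by (intro nn_integral_cmult hh)
  also have "\<dots> \<le> ennreal (1 / B) * ennreal B" by (intro mult_left_mono le) auto
  also have "\<dots> = 1" using B by (simp add: ennreal_mult'[symmetric])
  finally show ?thesis by (simp add: B_def)
qed

lemma dilation_norm_upper_ennreal:
  assumes a: "0 < a" and A: "0 < A" and u0: "0 < u0"
    and grow: "\<And>w. u0 \<le> w \<Longrightarrow> u0 \<le> A * w \<Longrightarrow> a * F w \<le> F (A * w)"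
  shows "(SUP f\<in>{f \<in> orlicz_space F. orlicz_norm F f \<le> 1}. orlicz_norm F (dilation a f))
    \<le> ennreal (A * (1 + F u0))"
proof (rule SUP_least)
  fix f assume "f \<in> {f \<in> orlicz_space F. orlicz_norm F f \<le> 1}"
  then have f: "f \<in> borel_measurable (lebesgue_on {0..1})" "orlicz_norm F f \<le> 1"
    by (auto simp: orlicz_space_def)
  define B where "B = 1 + F u0"
  have B: "1 \<le> B" using F_nonneg[of u0] u0 by (simp add: B_def)
  show "orlicz_norm F (dilation a f) \<le> ennreal (A * (1 + F u0))"
  proof (rule ennreal_le_epsilon)
    fix e :: real assume e: "0 < e"
    \<comment> \<open>\<open>scaled_modular_le_1\<close> needs a scale strictly above the norm; this
      slack makes \<open>\<beta> * A * B\<close> exactly \<open>A * B + e\<close>.\<close>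
    define \<beta> where "\<beta> = 1 + e / (A * B)"
    have \<beta>: "1 < \<beta>" using e A B by (simp add: \<beta>_def)
    then have "orlicz_norm F f < ennreal \<beta>" using f(2) by (simp add: order_le_less_trans)
    then have f1: "scaled_modular f \<beta> \<le> 1" by (rule scaled_modular_le_1)
    have "orlicz_norm F (dilation a f) \<le> ennreal (\<beta> * A * B)"
      unfolding B_def using \<beta> A B
      by (intro orlicz_norm_le scaled_modular_dilation_le_1[OF a A u0 grow f(1) f1]) (auto simp: B_def)
    also have "\<beta> * A * B = A * B + e" using A B by (simp add: \<beta>_def field_simps)
    finally show "orlicz_norm F (dilation a f) \<le> ennreal (A * (1 + F u0)) + ennreal e"
      using A B e by (subst ennreal_plus[symmetric]) (auto simp: B_def[symmetric])
  qed
qed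

end

subsection \<open>Dyadic sequences\<close>

abbreviation dyadic_interval :: "int \<Rightarrow> real set" where
  "dyadic_interval n \<equiv> {2 powi n..<2 powi (n + 1)}"

lemma dyadic_interval_unique:
  assumes "t \<in> dyadic_interval m" "t \<in> dyadic_interval n"
  shows "m = n"
proof -
  have "m < n + 1" if "t \<in> dyadic_interval m" "t \<in> dyadic_interval n" for m n
  proof (rule ccontr)
    assume "\<not> m < n + 1"
    then have "(2::real) powi (n + 1) \<le> 2 powi m" by (intro power_int_increasing) auto
    with that show False by auto
  qed
  from this[of m n] this[of n m] assms show ?thesis by auto
qed

lemma dyadic_interval_subset: "n < 0 \<Longrightarrow> dyadic_interval n \<subseteq> {0..1}"
proof
  fix t assume "n < 0" "t \<in> dyadic_interval n"
  moreover have "(2::real) powi (n + 1) \<le> 2 powi 0"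
    using \<open>n < 0\<close> by (intro power_int_increasing) auto
  moreover have "(0::real) < 2 powi n" by simp
  ultimately show "t \<in> {0..1}" unfolding atLeastLessThan_iff atLeastAtMost_iff power_int_0_right by linarith
qed

lemma emeasure_dyadic_interval: "emeasure lebesgue (dyadic_interval n) = ennreal (2 powi n)"
  by (simp add: power_int_add)

lemma dyadic_bracket:
  fixes y :: real
  assumes "0 < y"
  obtains n where "y \<in> dyadic_interval n"
proof
  have "2 powr of_int \<lfloor>log 2 y\<rfloor> \<le> 2 powr (log 2 y)"
    "2 powr (log 2 y) < 2 powr of_int (\<lfloor>log 2 y\<rfloor> + 1)"
    by (simp, intro powr_less_mono) linarith+
  then show "y \<in> dyadic_interval \<lfloor>log 2 y\<rfloor>"
    using assms by (simp add: powr_real_of_int' del: of_int_add)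
qed

lemma dyadic_step_function:
  assumes "finite S" "S \<subseteq> {..<0}" "\<And>n. n \<notin> S \<Longrightarrow> x n = 0"
  shows "(\<Sum>\<^sub>\<infinity>n\<in>{..<0}. x n * indicator (dyadic_interval n) t)
    = (\<Sum>n\<in>S. x n * indicator (dyadic_interval n) t :: real)"
proof -
  have "(\<Sum>\<^sub>\<infinity>n\<in>{..<0}. x n * indicator (dyadic_interval n) t)
    = (\<Sum>\<^sub>\<infinity>n\<in>S. x n * indicator (dyadic_interval n) t)"
    using assms by (intro infsum_cong_neutral) auto
  with assms show ?thesis by simp
qed

context orlicz
begin

text \<open>At each point at most one summand of the step function is nonzero, and
  \<open>F 0 = 0\<close>, so \<open>F\<close> passes through the sum.\<close>

lemma scaled_modular_dyadic:
  assumes S: "finite S" "S \<subseteq> {..<0}" "\<And>n. n \<notin> S \<Longrightarrow> x n = 0" and "0 < \<alpha>"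
  shows "scaled_modular (\<lambda>t. \<Sum>\<^sub>\<infinity>n\<in>{..<0}. x n * indicator (dyadic_interval n) t) \<alpha>
    = ennreal (\<Sum>n\<in>S. F (\<bar>x n\<bar> / \<alpha>) * 2 powi n)"
proof -
  have step: "(\<Sum>\<^sub>\<infinity>n\<in>{..<0}. x n * indicator (dyadic_interval n) t)
    = (\<Sum>n\<in>S. x n * indicator (dyadic_interval n) t :: real)" for t
    using S by (rule dyadic_step_function)
  have eq: "ennreal (F (\<bar>\<Sum>n\<in>S. x n * indicator (dyadic_interval n) t\<bar> / \<alpha>))
      = (\<Sum>n\<in>S. ennreal (F (\<bar>x n * indicator (dyadic_interval n) t\<bar> / \<alpha>)))" for t
  proof (cases "\<exists>m\<in>S. t \<in> dyadic_interval m")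
    case True
    then obtain m where m: "m \<in> S" "t \<in> dyadic_interval m" by blast
    have z: "t \<notin> dyadic_interval n" if "n \<noteq> m" for n
      using dyadic_interval_unique[OF m(2), of n] that by blast
    have "(\<Sum>n\<in>S. x n * indicator (dyadic_interval n) t) = (\<Sum>n\<in>S. if n = m then x m else 0)"
      using m z by (intro sum.cong) (auto simp: indicator_def)
    then have "(\<Sum>n\<in>S. x n * indicator (dyadic_interval n) t) = x m"
      by (subst (asm) sum.delta) (use S(1) m in auto)
    moreover have "(\<Sum>n\<in>S. ennreal (F (\<bar>x n * indicator (dyadic_interval n) t\<bar> / \<alpha>)))
        = (\<Sum>n\<in>S. if n = m then ennreal (F (\<bar>x m\<bar> / \<alpha>)) else 0)"
      using m z by (intro sum.cong) (auto simp: indicator_def)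
    then have "(\<Sum>n\<in>S. ennreal (F (\<bar>x n * indicator (dyadic_interval n) t\<bar> / \<alpha>)))
        = ennreal (F (\<bar>x m\<bar> / \<alpha>))"
      by (subst (asm) sum.delta) (use S(1) m in auto)
    ultimately show ?thesis by (simp only:)
  next
    case False
    then have "\<And>n. n \<in> S \<Longrightarrow> indicator (dyadic_interval n) t = (0::real)"
      by (auto simp: indicator_def)
    then show ?thesis by simp
  qed
  have "scaled_modular (\<lambda>t. \<Sum>\<^sub>\<infinity>n\<in>{..<0}. x n * indicator (dyadic_interval n) t) \<alpha>
      = (\<integral>\<^sup>+t. (\<Sum>n\<in>S. ennreal (F (\<bar>x n * indicator (dyadic_interval n) t\<bar> / \<alpha>))) \<partial>lebesgue_on {0..1})"
    by (intro nn_integral_cong) (simp only: step eq)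
  also have "\<dots> = (\<Sum>n\<in>S. scaled_modular (\<lambda>t. x n * indicator (dyadic_interval n) t) \<alpha>)"
  proof (intro nn_integral_sum)
    fix n assume "n \<in> S"
    have "(\<lambda>t. x n * indicator (dyadic_interval n) t) \<in> borel_measurable (lebesgue_on {0..1})"
      by (intro measurable_restrict_space1 borel_measurable_times borel_measurable_const
          borel_measurable_indicator) simp
    from borel_measurable_F_abs[OF this \<open>0 < \<alpha>\<close>]
    show "(\<lambda>t. ennreal (F (\<bar>x n * indicator (dyadic_interval n) t\<bar> / \<alpha>)))
        \<in> borel_measurable (lebesgue_on {0..1})" by simp
  qed
  also have "\<dots> = (\<Sum>n\<in>S. ennreal (F (\<bar>x n\<bar> / \<alpha>) * 2 powi n))"
    using S(2) assms(4)
    by (intro sum.cong refl scaled_modular_indicator dyadic_interval_subset emeasure_dyadic_interval) auto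
  also have "\<dots> = ennreal (\<Sum>n\<in>S. F (\<bar>x n\<bar> / \<alpha>) * 2 powi n)"
    using assms(4) F_nonneg by (intro sum_ennreal) auto
  finally show ?thesis .
qed

end

section \<open>The right-shift property on normalized unit vectors\<close>

locale orlicz_basis = orlicz +
  fixes b :: "int \<Rightarrow> real"
  assumes b_pos: "0 < b n" and F_b: "F (b n) = 2 powi (- n)"
begin

text \<open>This is \<open>x\<close> times the sum of the normalized unit vectors with positions in
  \<open>S\<close>; \<open>block {s} 1\<close> is a single such vector.\<close>

definition block :: "int set \<Rightarrow> real \<Rightarrow> int \<Rightarrow> real" where
  "block S x k = (if k \<in> S then x * b k else 0)"

text \<open>Since \<open>F (b n) = 2 powi (- n)\<close>, the value \<open>\<phi> n x\<close> is \<open>F (b n * x) / F (b n)\<close>.\<close>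

definition \<phi> :: "int \<Rightarrow> real \<Rightarrow> real" where
  "\<phi> n x = F (b n * x) * 2 powi n"

text \<open>The modular of \<open>block S x\<close> at scale \<open>\<alpha>\<close> is the sum of
  \<open>\<phi> n (x / \<alpha>)\<close> over \<open>S\<close>. This lemma and the next use that
  identity in the two directions between norms and sums of \<open>\<phi>\<close>.\<close>

lemma dyadic_norm_block_le_1:
  assumes "finite S" "S \<subseteq> {..<0}" "0 \<le> x" "(\<Sum>n\<in>S. \<phi> n x) \<le> 1"
  shows "dyadic_norm F (block S x) \<le> 1"
proof -
  have "scaled_modular (\<lambda>t. \<Sum>\<^sub>\<infinity>n\<in>{..<0}. block S x n * indicator (dyadic_interval n) t) 1
      = ennreal (\<Sum>n\<in>S. F (\<bar>block S x n\<bar> / 1) * 2 powi n)"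
    using assms by (intro scaled_modular_dyadic) (auto simp: block_def)
  also have "(\<Sum>n\<in>S. F (\<bar>block S x n\<bar> / 1) * 2 powi n) = (\<Sum>n\<in>S. \<phi> n x)"
    using assms b_pos by (intro sum.cong) (auto simp: block_def \<phi>_def abs_mult ac_simps less_imp_le)
  also have "ennreal \<dots> \<le> 1" using assms by (simp add: ennreal_le_1)
  finally show ?thesis
    unfolding dyadic_norm_def using orlicz_norm_le[of 1] by simp
qed

lemma sum_\<phi>_le_1_of_dyadic_norm_block:
  assumes "finite S" "S \<subseteq> {..<0}" "0 \<le> x" "0 < \<alpha>" "dyadic_norm F (block S x) < ennreal \<alpha>"
  shows "(\<Sum>n\<in>S. \<phi> n (x / \<alpha>)) \<le> 1"
proof -
  have "ennreal (\<Sum>n\<in>S. F (\<bar>block S x n\<bar> / \<alpha>) * 2 powi n)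
      = scaled_modular (\<lambda>t. \<Sum>\<^sub>\<infinity>n\<in>{..<0}. block S x n * indicator (dyadic_interval n) t) \<alpha>"
    using assms by (intro scaled_modular_dyadic[symmetric]) (auto simp: block_def)
  also have "\<dots> \<le> 1"
    using assms(5) by (intro scaled_modular_le_1) (simp add: dyadic_norm_def)
  also have "(\<Sum>n\<in>S. F (\<bar>block S x n\<bar> / \<alpha>) * 2 powi n) = (\<Sum>n\<in>S. \<phi> n (x / \<alpha>))"
    using assms b_pos by (intro sum.cong) (auto simp: block_def \<phi>_def abs_mult ac_simps less_imp_le)
  finally show ?thesis by (simp add: ennreal_le_1)
qed

text \<open>The interval at position \<open>s\<close> has measure \<open>2 powi s\<close>, the
  reciprocal of \<open>F (b s)\<close>.\<close>

lemma dyadic_norm_basis: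
  assumes "s < 0"
  shows "dyadic_norm F (block {s} 1) = 1"
proof -
  have "(\<lambda>t. \<Sum>\<^sub>\<infinity>n\<in>{..<0}. block {s} 1 n * indicator (dyadic_interval n) t)
      = (\<lambda>t. b s * indicator (dyadic_interval s) t :: real)"
    using assms by (subst dyadic_step_function[of "{s}"]) (auto simp: block_def simp del: sum_mult_indicator)
  moreover have "orlicz_norm F (\<lambda>t. b s * indicator (dyadic_interval s) t) = ennreal (\<bar>b s\<bar> / b s)"
    using assms b_pos F_b
    by (intro orlicz_norm_indicator[OF _ dyadic_interval_subset emeasure_dyadic_interval])
      (auto simp: power_int_minus field_simps)
  ultimately show ?thesis using b_pos[of s] by (simp add: dyadic_norm_def)
qed

lemma seq_supp_basis: "seq_supp (block {s} 1) = {s}"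
  using b_pos[of s] by (auto simp: seq_supp_def block_def)

lemma basis_in_dyadic_space: "s < 0 \<Longrightarrow> block {s} 1 \<in> dyadic_space F"
  by (auto simp: dyadic_space_def dyadic_norm_basis) (auto simp: block_def)

text \<open>The sequences of positions used below decrease, whereas interlaced pairs increase; hence the
  index \<open>- n\<close>.\<close>

lemma lin_comb_basis:
  fixes s :: "nat \<Rightarrow> int"
  assumes "inj s" "x \<noteq> 0"
  shows "lin_comb {1 - int N..0} (\<lambda>_. x) (\<lambda>n. block {s (nat (- n))} 1) = block (s ` {..<N}) x"
proof
  fix k
  have bij: "bij_betw (\<lambda>i. - int i) {..<N} {1 - int N..0}"
    by (rule bij_betwI[of _ _ _ "\<lambda>n. nat (- n)"]) auto
  have "lin_comb {1 - int N..0} (\<lambda>_. x) (\<lambda>n. block {s (nat (- n))} 1) k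
      = (\<Sum>n\<in>{1 - int N..0}. x * block {s (nat (- n))} 1 k)"
    using assms by (auto simp: lin_comb_def intro: sum.cong)
  also have "\<dots> = (\<Sum>i<N. x * block {s i} 1 k)"
    by (subst sum.reindex_bij_betw[OF bij, symmetric]) simp
  also have "\<dots> = (\<Sum>j\<in>s ` {..<N}. x * block {j} 1 k)"
    using assms by (subst sum.reindex) (auto intro: inj_on_subset)
  also have "\<dots> = (\<Sum>j\<in>s ` {..<N}. if k = j then x * b k else 0)"
    by (intro sum.cong) (auto simp: block_def)
  also have "\<dots> = block (s ` {..<N}) x k" by (subst sum.delta') (auto simp: block_def)
  finally show "lin_comb {1 - int N..0} (\<lambda>_. x) (\<lambda>n. block {s (nat (- n))} 1) k
      = block (s ` {..<N}) x k" .
qed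

text \<open>With all coefficients equal to \<open>x\<close>, the left block has norm at most 1, so
  the right block has norm at most the shift constant \<open>C\<close>. Some \<open>2 ^ j\<close>
  exceeds \<open>C\<close>, and \<open>j\<close> uses of the \<Delta>2-condition remove the
  resulting scale \<open>2 ^ j\<close>. The bound depends on neither \<open>x\<close> nor
  \<open>N\<close>.\<close>

lemma rsp_comparison:
  assumes rsp: "right_shift_property (dyadic_space F) (dyadic_norm F)" and "delta2_condition F"
  obtains K where "1 \<le> K"
    and "\<And>s t N x. (\<And>i::nat. s i < t i \<and> t i < 0 \<and> t (Suc i) < s i) \<Longrightarrow> 0 < x \<Longrightarrow>
      (\<Sum>i<N. \<phi> (s i) x) \<le> 1 \<Longrightarrow> (\<Sum>i<N. \<phi> (t i) x) \<le> K"
proof -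
  from rsp obtain C where C: "\<And>I x y \<alpha>. int_interval I \<Longrightarrow> interlaced (dyadic_space F) I x y \<Longrightarrow>
        (\<And>n. n \<in> I \<Longrightarrow> dyadic_norm F (y n) \<le> dyadic_norm F (x n) \<and> dyadic_norm F (x n) = 1) \<Longrightarrow>
        finite {n\<in>I. \<alpha> n \<noteq> 0} \<Longrightarrow>
        dyadic_norm F (lin_comb I \<alpha> y) \<le> ennreal C * dyadic_norm F (lin_comb I \<alpha> x)"
    unfolding right_shift_property_def by blast
  from assms(2) obtain \<Delta> where \<Delta>: "\<And>x. 0 \<le> x \<Longrightarrow> F (2 * x) \<le> \<Delta> * F x"
    unfolding delta2_condition_def by blast
  \<comment> \<open>Convexity forces \<open>2 \<le> \<Delta>\<close>, hence powers of
    \<open>\<Delta>\<close> are at least 1.\<close>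
  have "2 * F 1 \<le> \<Delta> * F 1" using \<Delta>[of 1] F_scale_ge[of 2 1] by simp
  then have "2 \<le> \<Delta>" using F_pos[of 1] by simp
  have pow: "F (2 ^ j * x) \<le> \<Delta> ^ j * F x" if "0 \<le> x" for j x
  proof (induction j)
    case (Suc j)
    have "F (2 ^ Suc j * x) \<le> \<Delta> * F (2 ^ j * x)" using \<Delta>[of "2 ^ j * x"] that by (simp add: ac_simps)
    also have "\<dots> \<le> \<Delta> * (\<Delta> ^ j * F x)" using Suc \<open>2 \<le> \<Delta>\<close> by (intro mult_left_mono) auto
    finally show ?case by (simp add: ac_simps)
  qed simp
  obtain j where j: "C < 2 ^ j" using real_arch_pow[of 2 C] by auto
  show ?thesis
  proof
    show "1 \<le> \<Delta> ^ j" using \<open>2 \<le> \<Delta>\<close> by (intro one_le_power) auto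
  next
    fix s t :: "nat \<Rightarrow> int" and N x
    assume st: "\<And>i. s i < t i \<and> t i < 0 \<and> t (Suc i) < s i" and x: "0 < x"
      and le: "(\<Sum>i<N. \<phi> (s i) x) \<le> 1"
    have "strict_mono (\<lambda>i. - s i)" using st by (intro strict_monoI_Suc) (metis neg_less_iff_less order.strict_trans)
    then have injs: "inj s" by (intro injI) (metis strict_mono_eq)
    have "strict_mono (\<lambda>i. - t i)" using st by (intro strict_monoI_Suc) (metis neg_less_iff_less order.strict_trans)
    then have injt: "inj t" by (intro injI) (metis strict_mono_eq)
    have neg: "s i < 0" "t i < 0" for i using st[of i] by auto
    define I where "I = {1 - int N..0}"
    define X where "X n = block {s (nat (- n))} 1" for n
    define Y where "Y n = block {t (nat (- n))} 1" for n
    have "interlaced (dyadic_space F) I X Y"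
      unfolding interlaced_def
    proof (intro conjI allI ballI impI)
      fix n assume n: "n \<in> I \<and> n + 1 \<in> I"
      \<comment> \<open>Passing from \<open>n\<close> to \<open>n + 1\<close> lowers the index of
        the positions by one, so the condition becomes \<open>t (Suc i) < s i\<close>.\<close>
      then have "nat (- n) = Suc (nat (- (n + 1)))" by (auto simp: I_def)
      then show "set_less (seq_supp (Y n)) (seq_supp (X (n + 1)))"
        using st by (simp add: X_def Y_def seq_supp_basis set_less_def)
    qed (use st neg in \<open>auto simp: X_def Y_def seq_supp_basis set_less_def basis_in_dyadic_space\<close>)
    then have "dyadic_norm F (lin_comb I (\<lambda>_. x) Y) \<le> ennreal C * dyadic_norm F (lin_comb I (\<lambda>_. x) X)"
      using x by (intro C) (auto simp: X_def Y_def dyadic_norm_basis neg int_interval_def I_def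
          intro: rev_finite_subset[of "{1 - int N..0}"])
    also have "lin_comb I (\<lambda>_. x) X = block (s ` {..<N}) x"
      unfolding I_def X_def using injs x by (intro lin_comb_basis) auto
    also have "lin_comb I (\<lambda>_. x) Y = block (t ` {..<N}) x"
      unfolding I_def Y_def using injt x by (intro lin_comb_basis) auto
    finally have "dyadic_norm F (block (t ` {..<N}) x) \<le> ennreal C * dyadic_norm F (block (s ` {..<N}) x)" .
    also have "\<dots> \<le> ennreal C * 1"
    proof (intro mult_left_mono dyadic_norm_block_le_1)
      have "(\<Sum>n\<in>s ` {..<N}. \<phi> n x) = (\<Sum>i<N. \<phi> (s i) x)"
        using injs by (subst sum.reindex) (auto intro: inj_on_subset)
      then show "(\<Sum>n\<in>s ` {..<N}. \<phi> n x) \<le> 1" using le by simp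
    qed (use x neg in auto)
    also have "\<dots> < ennreal (2 ^ j)" using j by (simp add: ennreal_less_iff ennreal_lessI)
    finally have "(\<Sum>n\<in>t ` {..<N}. \<phi> n (x / 2 ^ j)) \<le> 1"
      using x neg by (intro sum_\<phi>_le_1_of_dyadic_norm_block) auto
    also have "(\<Sum>n\<in>t ` {..<N}. \<phi> n (x / 2 ^ j)) = (\<Sum>i<N. \<phi> (t i) (x / 2 ^ j))"
      using injt by (subst sum.reindex) (auto intro: inj_on_subset)
    finally have 1: "(\<Sum>i<N. \<phi> (t i) (x / 2 ^ j)) \<le> 1" .
    have "(\<Sum>i<N. \<phi> (t i) x) \<le> (\<Sum>i<N. \<Delta> ^ j * \<phi> (t i) (x / 2 ^ j))"
    proof (intro sum_mono)
      fix i
      have "F (b (t i) * x) \<le> \<Delta> ^ j * F (b (t i) * (x / 2 ^ j))"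
        using pow[of "b (t i) * (x / 2 ^ j)" j] x b_pos[of "t i"] by (simp add: field_simps)
      then show "\<phi> (t i) x \<le> \<Delta> ^ j * \<phi> (t i) (x / 2 ^ j)"
        unfolding \<phi>_def mult.assoc[symmetric] by (intro mult_right_mono) auto
    qed
    also have "\<dots> = \<Delta> ^ j * (\<Sum>i<N. \<phi> (t i) (x / 2 ^ j))" by (rule sum_distrib_left[symmetric])
    also have "\<dots> \<le> \<Delta> ^ j * 1" using \<open>2 \<le> \<Delta>\<close> 1 by (intro mult_left_mono) auto
    finally show "(\<Sum>i<N. \<phi> (t i) x) \<le> \<Delta> ^ j" by simp
  qed
qed

text \<open>Interlace about \<open>1 / e\<close> positions with small values, each to the left of
  one with a large value. The small values sum to at most 1, the large ones to more than
  \<open>K\<close>, against \<open>rsp_comparison\<close>.\<close>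

lemma no_two_scales:
  assumes "right_shift_property (dyadic_space F) (dyadic_norm F)" and "delta2_condition F"
  obtains K where "1 \<le> K"
    and "\<And>x e. 0 < x \<Longrightarrow> 0 < e \<Longrightarrow> e \<le> 1 \<Longrightarrow> (\<And>m. \<exists>n<m. \<phi> n x < e) \<Longrightarrow>
      (\<And>m. \<exists>n<m. 2 * K * e < \<phi> n x) \<Longrightarrow> False"
proof -
  from rsp_comparison[OF assms] obtain K where "1 \<le> K"
    and K: "\<And>s t N x. (\<And>i::nat. s i < t i \<and> t i < 0 \<and> t (Suc i) < s i) \<Longrightarrow> 0 < x \<Longrightarrow>
      (\<Sum>i<N. \<phi> (s i) x) \<le> 1 \<Longrightarrow> (\<Sum>i<N. \<phi> (t i) x) \<le> K" by blast
  show ?thesis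
  proof (rule that[OF \<open>1 \<le> K\<close>])
    fix x e :: real
    assume x: "0 < x" and e: "0 < e" "e \<le> 1" and small: "\<And>m. \<exists>n<m. \<phi> n x < e"
      and large: "\<And>m. \<exists>n<m. 2 * K * e < \<phi> n x"
    define P where "P = (\<lambda>p. \<phi> (fst p) x < e \<and> 2 * K * e < \<phi> (snd p) x \<and> fst p < snd p \<and> snd p < 0)"
    \<comment> \<open>The position \<open>t\<close> of a large value is chosen first and
      \<open>s\<close> further left; both kinds recur towards minus infinity.\<close>
    have ex: "\<exists>p. P p \<and> snd p < m" for m
    proof -
      from large[of "min m 0"] obtain t where "t < min m 0" "2 * K * e < \<phi> t x" by blast
      moreover from small[of t] obtain s where "s < t" "\<phi> s x < e" by blast
      ultimately show ?thesis by (intro exI[of _ "(s, t)"]) (auto simp: P_def)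
    qed
    have "\<exists>f. \<forall>i. P (f i) \<and> snd (f (Suc i)) < fst (f i)"
      using ex by (intro dependent_nat_choice[of "\<lambda>_. P" "\<lambda>_ p q. snd q < fst p"]) blast+
    then obtain f where f: "\<And>i. P (f i)" "\<And>i. snd (f (Suc i)) < fst (f i)" by blast
    \<comment> \<open>The largest \<open>N\<close> with \<open>N * e \<le> 1\<close>. Since
      \<open>N \<ge> 1\<close>, also \<open>2 * N \<ge> N + 1 > 1 / e\<close>, which explains the
      factor 2 in the threshold \<open>2 * K * e\<close>.\<close>
    define N where "N = nat \<lfloor>1 / e\<rfloor>"
    have "1 \<le> 1 / e" using e by simp
    moreover from this have "real N = of_int \<lfloor>1 / e\<rfloor>" using of_nat_nat[of "\<lfloor>1 / e\<rfloor>"] unfolding N_def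
      by (metis of_int_of_nat_eq of_nat_nat one_le_floor order_trans zero_le_one)
    ultimately have N1: "1 \<le> real N" "real N \<le> 1 / e" "1 / e < real N + 1"
      using one_le_floor[of "1 / e"] by (linarith, linarith, linarith)
    then have N: "real N * e \<le> 1" "1 < 2 * real N * e"
      using e by (auto simp: field_simps intro: less_le_trans)
    have "(\<Sum>i<N. \<phi> (fst (f i)) x) \<le> (\<Sum>i<N. e)"
      using f by (intro sum_mono) (auto simp: P_def less_imp_le)
    also have "\<dots> \<le> 1" using N by simp
    finally have "(\<Sum>i<N. \<phi> (snd (f i)) x) \<le> K"
      using f x by (intro K[of "\<lambda>i. fst (f i)"]) (auto simp: P_def)
    moreover have "(\<Sum>i<N. 2 * K * e) \<le> (\<Sum>i<N. \<phi> (snd (f i)) x)"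
      using f by (intro sum_mono) (auto simp: P_def less_imp_le)
    moreover have "K * 1 < K * (2 * real N * e)" using N \<open>1 \<le> K\<close> by (intro mult_strict_left_mono) auto
    ultimately show False by (simp add: ac_simps)
  qed
qed

text \<open>For \<open>x = 1 / l\<close>, \<open>\<phi> n x\<close> is the reciprocal of the growth
  ratio \<open>F (l * t) / F t\<close> at \<open>t = b n / l\<close>. Slow growth at some places and
  fast growth at others, both recurring, would give two scales of \<open>\<phi>\<close>. It is
  essential that \<open>K\<close> does not depend on \<open>l\<close>.\<close>

lemma growth_comparison:
  assumes "right_shift_property (dyadic_space F) (dyadic_norm F)" and "delta2_condition F"
  obtains K where "1 \<le> K"
    and "\<And>l c. 1 \<le> l \<Longrightarrow> \<exists>\<^sub>F t in at_top. F (l * t) < c * F t \<Longrightarrow>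
      \<forall>\<^sub>F t in at_top. F (l * t) \<le> K * c * F t"
proof -
  from no_two_scales[OF assms] obtain K where "1 \<le> K"
    and K: "\<And>x e. 0 < x \<Longrightarrow> 0 < e \<Longrightarrow> e \<le> 1 \<Longrightarrow> (\<And>m. \<exists>n<m. \<phi> n x < e) \<Longrightarrow>
      (\<And>m. \<exists>n<m. 2 * K * e < \<phi> n x) \<Longrightarrow> False" by blast
  have b_mono: "m \<le> n" if "b n \<le> b m" for m n
  proof (rule ccontr)
    assume "\<not> m \<le> n"
    then have "(2::real) powi (- m) < 2 powi (- n)" by (intro power_int_strict_increasing) auto
    then show False using that F_le_iff[of "b n" "b m"] b_pos[of n] b_pos[of m] by (simp add: F_b)
  qed
  \<comment> \<open>Any large \<open>u\<close> lies between consecutive points of the decreasing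
    sequence \<open>b\<close>, with a loss of at most 2 in \<open>F\<close>. Starting at
    \<open>b (m - 2)\<close> ensures \<open>n - 1 \<le> m - 2\<close>, hence
    \<open>n < m\<close>.\<close>
  have bracket: "\<exists>n<m. b n \<le> u \<and> u \<le> b (n - 1) \<and> F u \<le> 2 * F (b n) \<and> F (b (n - 1)) \<le> 2 * F u"
    if u: "b (m - 2) \<le> u" for u m
  proof -
    have "0 < u" using u b_pos[of "m - 2"] by simp
    then obtain k where k: "F u \<in> dyadic_interval k" using dyadic_bracket[OF F_pos] by blast
    define n where "n = - k"
    have n: "F (b n) \<le> F u" "F u < F (b (n - 1))" using k by (auto simp: F_b n_def add.commute)
    have "b n \<le> u" "u < b (n - 1)" using n \<open>0 < u\<close> b_pos[of n] b_pos[of "n - 1"]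
      by (auto simp: F_le_iff F_less_iff)
    moreover have "n - 1 \<le> m - 2" using u \<open>u < b (n - 1)\<close> by (intro b_mono) auto
    moreover have "F (b (n - 1)) = 2 * F (b n)" by (simp add: F_b power_int_diff power_int_minus field_simps power_int_add)
    ultimately show ?thesis using n by (intro exI[of _ n]) auto
  qed
  show ?thesis
  \<comment> \<open>The 8 is the factor 2 of \<open>no_two_scales\<close> times a factor 2 for
    bracketing in each of the two cases.\<close>
  proof (rule that[of "8 * K"])
    show "1 \<le> 8 * K" using \<open>1 \<le> K\<close> by simp
  next
    fix l c :: real
    assume l: "1 \<le> l" and fr: "\<exists>\<^sub>F t in at_top. F (l * t) < c * F t"
    have small: "\<exists>t\<ge>m. F (l * t) < c * F t" for m
      using fr unfolding frequently_def eventually_at_top_linorder by (auto simp: not_le)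
    from small[of 1] obtain t where t: "1 \<le> t" "F (l * t) < c * F t" by blast
    have "F t \<le> F (l * t)" using t l mult_right_mono[of 1 l t] by (subst F_le_iff) auto
    with t have "1 * F t < c * F t" by simp
    then have c: "1 < c" using F_pos[of t] t by simp
    define x where "x = 1 / l"
    have x: "0 < x" using l by (simp add: x_def)
    \<comment> \<open>Chosen so that growth below \<open>c\<close> gives values of
      \<open>\<phi>\<close> above \<open>2 * K * e = 1 / (2 * c)\<close>, and growth above
      \<open>8 * K * c\<close> gives values below \<open>e\<close>.\<close>
    define e where "e = 1 / (4 * K * c)"
    have "1 \<le> K * c" using mult_mono[of 1 K 1 c] \<open>1 \<le> K\<close> c by simp
    then have e: "0 < e" "e \<le> 1" "2 * K * e = 1 / (2 * c)" using \<open>1 \<le> K\<close> c by (auto simp: e_def field_simps)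
    show "\<forall>\<^sub>F t in at_top. F (l * t) \<le> 8 * K * c * F t"
    proof (rule ccontr)
      assume "\<not> ?thesis"
      then have large: "\<exists>t\<ge>m. 8 * K * c * F t < F (l * t)" for m
        unfolding eventually_at_top_linorder by (auto simp: not_le)
      show False
      proof (rule K[OF x e(1,2)])
        \<comment> \<open>Small values of \<open>\<phi>\<close> come from fast growth and, in the
          second case, large values from slow growth.\<close>
        fix m
        from large[of "b (m - 2)"] obtain t where t: "b (m - 2) \<le> t" "8 * K * c * F t < F (l * t)" by blast
        have t0: "0 < t" using t b_pos[of "m - 2"] by simp
        then have "b (m - 2) \<le> l * t" using t(1) l mult_right_mono[of 1 l t] by linarith
        from bracket[OF this] obtain n where n: "n < m" "b n \<le> l * t" "F (l * t) \<le> 2 * F (b n)" by blast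
        have "b n * x \<le> t" using n l by (simp add: x_def field_simps)
        then have "F (b n * x) \<le> F t" using t0 b_pos[of n] x by (subst F_le_iff) auto
        also have "\<dots> < 2 * F (b n) / (8 * K * c)"
          using t n \<open>1 \<le> K\<close> c by (simp add: field_simps)
        finally have "F (b n * x) < F (b n) * e" by (simp add: e_def)
        then have "\<phi> n x < F (b n) * e * 2 powi n" unfolding \<phi>_def by (intro mult_strict_right_mono) auto
        then have "\<phi> n x < e" by (simp add: F_b power_int_minus field_simps)
        with n show "\<exists>n<m. \<phi> n x < e" by blast
      next
        fix m
        from small[of "b (m - 2)"] obtain t where t: "b (m - 2) \<le> t" "F (l * t) < c * F t" by blast
        have t0: "0 < t" using t b_pos[of "m - 2"] by simp
        then have "b (m - 2) \<le> l * t" using t(1) l mult_right_mono[of 1 l t] by linarith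
        from bracket[OF this] obtain n where n: "n < m" "l * t \<le> b (n - 1)" "F (b (n - 1)) \<le> 2 * F (l * t)" by blast
        have "t \<le> b (n - 1) * x" using n l by (simp add: x_def field_simps)
        then have "F t \<le> F (b (n - 1) * x)" using t0 b_pos[of "n - 1"] x by (subst F_le_iff) auto
        moreover have "F (b (n - 1)) / (2 * c) < F t"
          using t n c by (simp add: field_simps)
        ultimately have "F (b (n - 1)) * (2 * K * e) < F (b (n - 1) * x)" by (simp add: e(3))
        then have "F (b (n - 1)) * (2 * K * e) * 2 powi (n - 1) < \<phi> (n - 1) x"
          unfolding \<phi>_def by (intro mult_strict_right_mono) auto
        moreover have "F (b (n - 1)) * (2 * K * e) * 2 powi (n - 1) = 2 * K * e"
          unfolding F_b power_int_minus by simp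
        ultimately have "2 * K * e < \<phi> (n - 1) x" by simp
        with n show "\<exists>n<m. 2 * K * e < \<phi> n x" by (intro exI[of _ "n - 1"]) auto
      qed
    qed
  qed
qed

end

section \<open>Upper and lower estimates for the dilation norm\<close>

context orlicz
begin

text \<open>By convexity \<open>A = max 1 a\<close> satisfies the growth hypothesis. Finiteness
  matters because \<open>enn2real\<close> sends infinity to 0, which would spoil lower
  bounds.\<close>

lemma dilation_norm_finite:
  assumes a: "0 < a"
  shows "(SUP f\<in>{f \<in> orlicz_space F. orlicz_norm F f \<le> 1}. orlicz_norm F (dilation a f)) < \<infinity>"
proof -
  have "(SUP f\<in>{f \<in> orlicz_space F. orlicz_norm F f \<le> 1}. orlicz_norm F (dilation a f))
      \<le> ennreal (max 1 a * (1 + F 1))"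
  proof (rule dilation_norm_upper_ennreal[OF a])
    fix w :: real assume w: "1 \<le> w"
    have "a * F w \<le> max 1 a * F w" using F_nonneg[of w] w by (intro mult_right_mono) auto
    also have "\<dots> \<le> F (max 1 a * w)" using w by (intro F_scale_ge) auto
    finally show "a * F w \<le> F (max 1 a * w)" .
  qed auto
  then show ?thesis unfolding infinity_ennreal_def by (rule order_le_less_trans) (rule ennreal_less_top)
qed

lemma dilation_norm_upper:
  assumes "0 < a" "0 < A" "0 < u0"
    and "\<And>w. u0 \<le> w \<Longrightarrow> u0 \<le> A * w \<Longrightarrow> a * F w \<le> F (A * w)"
  shows "dilation_norm F a \<le> A * (1 + F u0)"
  unfolding dilation_norm_def
proof (rule enn2real_leI)
  show "0 \<le> A * (1 + F u0)" using assms F_nonneg[of u0] by simp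
qed (rule dilation_norm_upper_ennreal[OF assms])

text \<open>The test function is \<open>v\<close> on \<open>{0..1 / F v}\<close>, of norm one. Its
  dilation lives on \<open>{0..a / F v} = {0..1 / F w}\<close> and has norm \<open>v / w\<close>.
  Values of \<open>F\<close> at least 1 keep both segments inside \<open>{0..1}\<close>.\<close>

lemma dilation_norm_lower:
  assumes a: "0 < a" and v: "0 < v" "1 \<le> F v" and w: "0 < w" "1 \<le> F w" and eq: "F v = a * F w"
  shows "v / w \<le> dilation_norm F a"
proof -
  have seg: "{0..1 / F u} \<in> sets lebesgue" "{0..1 / F u} \<subseteq> {0..1}"
      "emeasure lebesgue {0..1 / F u} = ennreal (1 / F u)" "0 < 1 / F u" if "1 \<le> F u" for u
  proof -
    have "0 \<le> 1 / F u" "1 / F u \<le> 1" "0 < 1 / F u" using that by (auto simp: field_simps)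
    then show "{0..1 / F u} \<in> sets lebesgue" "{0..1 / F u} \<subseteq> {0..1}"
      "emeasure lebesgue {0..1 / F u} = ennreal (1 / F u)" "0 < 1 / F u" by auto
  qed
  define f where "f = (\<lambda>t. v * indicator {0..1 / F v} t :: real)"
  have nf: "orlicz_norm F f = ennreal (\<bar>v\<bar> / v)"
    unfolding f_def using v by (intro orlicz_norm_indicator[OF seg]) auto
  have "f \<in> borel_measurable (lebesgue_on {0..1})"
    unfolding f_def by (intro measurable_restrict_space1 borel_measurable_times borel_measurable_const
          borel_measurable_indicator) simp
  with nf v have f: "f \<in> {f \<in> orlicz_space F. orlicz_norm F f \<le> 1}"
    by (simp add: orlicz_space_def)
  \<comment> \<open>The cutoff \<open>t \<le> a\<close> built into \<open>dilation\<close> removes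
    nothing, since \<open>1 \<le> F v\<close> gives \<open>1 / F w \<le> a\<close>.\<close>
  have "t \<le> a \<and> t / a \<le> 1 / F v \<longleftrightarrow> t \<le> 1 / F w" for t
  proof -
    have "t / a \<le> 1 / F v \<longleftrightarrow> t \<le> 1 / F w" using a w v eq by (simp add: field_simps)
    moreover have "1 / F w \<le> a" using a w v eq by (simp add: field_simps)
    ultimately show ?thesis by linarith
  qed
  then have "dilation a f = (\<lambda>t. v * indicator {0..1 / F w} t)"
    using a by (auto simp: dilation_def f_def indicator_def fun_eq_iff field_simps)
  then have "orlicz_norm F (dilation a f) = ennreal (\<bar>v\<bar> / w)"
    using w by (simp only:) (intro orlicz_norm_indicator[OF seg], auto)
  then have "ennreal (v / w)
      \<le> (SUP f\<in>{f \<in> orlicz_space F. orlicz_norm F f \<le> 1}. orlicz_norm F (dilation a f))"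
    using v by (intro SUP_upper2[OF f]) simp
  from enn2real_mono[OF this] dilation_norm_finite[OF a] v w show ?thesis
    by (simp add: dilation_norm_def infinity_ennreal_def)
qed

end

subsection \<open>Growth exponents\<close>

lemma power_bracket:
  fixes A l :: real
  assumes "1 \<le> A" "1 < l"
  obtains n where "l ^ n \<le> A" "A < l ^ Suc n"
proof -
  obtain N where N: "A < l ^ N" using real_arch_pow[OF assms(2)] by blast
  define n where "n = (LEAST N. A < l ^ N)"
  have n: "A < l ^ n" unfolding n_def using N by (rule LeastI)
  then obtain m where m: "n = Suc m" using assms(1) by (cases n) auto
  have "\<not> A < l ^ m" using not_less_Least[of m "\<lambda>N. A < l ^ N"] m by (simp add: n_def[symmetric])
  then show ?thesis using n m that[of m] by simp
qed

context orlicz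
begin

text \<open>Iterating \<open>step\<close> settles \<open>A = l ^ n\<close>. For other
  \<open>A\<close>, rounding down to a power of \<open>l\<close> costs one factor
  \<open>l powr r\<close>.\<close>

lemma growth_lower:
  assumes t0: "0 < t0" and l: "1 < l" and r: "0 < r"
    and step: "\<And>t. t0 \<le> t \<Longrightarrow> l powr r * F t \<le> F (l * t)"
    and t: "t0 \<le> t" and A: "1 \<le> A"
  shows "A powr r * F t \<le> l powr r * F (A * t)"
proof -
  have grow: "t0 \<le> l ^ n * t" for n
    using mult_mono[of 1 "l ^ n" t0 t] l t t0 by simp
  have pow: "(l ^ n) powr r * F t \<le> F (l ^ n * t)" for n
  proof (induction n)
    case (Suc n)
    have "(l ^ Suc n) powr r * F t = l powr r * ((l ^ n) powr r * F t)" using l by (simp add: powr_mult)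
    also have "\<dots> \<le> l powr r * F (l ^ n * t)" using Suc by (intro mult_left_mono) auto
    also have "\<dots> \<le> F (l * (l ^ n * t))" by (intro step grow)
    finally show ?case by (simp add: ac_simps)
  qed (use l in simp)
  obtain n where n: "l ^ n \<le> A" "A < l ^ Suc n" using power_bracket[OF A l] .
  have Ft: "0 \<le> F t" using F_nonneg t t0 by simp
  have "A powr r * F t \<le> (l ^ Suc n) powr r * F t"
    using n A r Ft by (intro mult_right_mono powr_mono2) auto
  also have "\<dots> = l powr r * ((l ^ n) powr r * F t)" using l by (simp add: powr_mult)
  also have "\<dots> \<le> l powr r * F (l ^ n * t)" by (intro mult_left_mono pow) auto
  also have "\<dots> \<le> l powr r * F (A * t)"
    using n t t0 A l by (intro mult_left_mono iffD2[OF F_le_iff] mult_right_mono) auto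
  finally show ?thesis .
qed

text \<open>As in \<open>growth_lower\<close>, but \<open>A\<close> is rounded up to a power of
  \<open>l\<close>.\<close>

lemma growth_upper:
  assumes t0: "0 < t0" and l: "1 < l" and r: "0 < r"
    and step: "\<And>t. t0 \<le> t \<Longrightarrow> F (l * t) \<le> l powr r * F t"
    and t: "t0 \<le> t" and A: "1 \<le> A"
  shows "F (A * t) \<le> l powr r * A powr r * F t"
proof -
  have grow: "t0 \<le> l ^ n * t" for n
    using mult_mono[of 1 "l ^ n" t0 t] l t t0 by simp
  have pow: "F (l ^ n * t) \<le> (l ^ n) powr r * F t" for n
  proof (induction n)
    case (Suc n)
    have "F (l ^ Suc n * t) = F (l * (l ^ n * t))" by (simp add: ac_simps)
    also have "\<dots> \<le> l powr r * F (l ^ n * t)" by (intro step grow)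
    also have "\<dots> \<le> l powr r * ((l ^ n) powr r * F t)" using Suc by (intro mult_left_mono) auto
    also have "\<dots> = (l ^ Suc n) powr r * F t" using l by (simp add: powr_mult)
    finally show ?case .
  qed (use l in simp)
  obtain n where n: "l ^ n \<le> A" "A < l ^ Suc n" using power_bracket[OF A l] .
  have Ft: "0 \<le> F t" using F_nonneg t t0 by simp
  have "F (A * t) \<le> F (l ^ Suc n * t)"
    using n t t0 A l by (intro iffD2[OF F_le_iff] mult_right_mono) auto
  also have "\<dots> \<le> (l ^ Suc n) powr r * F t" by (rule pow)
  also have "\<dots> = l powr r * (l ^ n) powr r * F t" using l by (simp add: powr_mult)
  also have "\<dots> \<le> l powr r * A powr r * F t"
    using n A r Ft l by (intro mult_right_mono mult_left_mono powr_mono2) auto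
  finally show ?thesis .
qed

end

context orlicz_basis
begin

text \<open>\<open>p\<close> is the supremum of the exponents that some power of 2 attains as a
  lower growth rate. An exponent above \<open>p\<close> fails for every \<open>k\<close>, and
  \<open>growth_comparison\<close> turns this failure into an upper estimate for all large
  \<open>t\<close>, up to the fixed factor \<open>K\<close>.\<close>

lemma growth_exponent:
  assumes rsp: "right_shift_property (dyadic_space F) (dyadic_norm F)" and delta2: "delta2_condition F"
  obtains p :: real where "1 \<le> p"
    and "\<And>\<delta>. 0 < \<delta> \<Longrightarrow> \<exists>k\<ge>1. \<forall>\<^sub>F t in at_top. (2 ^ k) powr (p - \<delta>) * F t \<le> F (2 ^ k * t)"
    and "\<And>\<delta>. 0 < \<delta> \<Longrightarrow> \<exists>k\<ge>1. \<forall>\<^sub>F t in at_top. F (2 ^ k * t) \<le> (2 ^ k) powr (p + \<delta>) * F t"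
proof -
  from growth_comparison[OF rsp delta2] obtain K where "1 \<le> K"
    and K: "\<And>l c. 1 \<le> l \<Longrightarrow> \<exists>\<^sub>F t in at_top. F (l * t) < c * F t \<Longrightarrow>
      \<forall>\<^sub>F t in at_top. F (l * t) \<le> K * c * F t" by blast
  from delta2 obtain \<Delta> where \<Delta>: "\<And>x. 0 \<le> x \<Longrightarrow> F (2 * x) \<le> \<Delta> * F x"
    unfolding delta2_condition_def by blast
  have "2 * F 1 \<le> \<Delta> * F 1" using \<Delta>[of 1] F_scale_ge[of 2 1] by simp
  then have "2 \<le> \<Delta>" using F_pos[of 1] by simp
  define L where "L = {r::real. \<exists>k\<ge>1. \<forall>\<^sub>F t in at_top. (2 ^ k) powr r * F t \<le> F (2 ^ k * t)}"
  have 1: "1 \<in> L"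
  proof -
    have "\<forall>\<^sub>F t in at_top. (2 ^ 1) powr 1 * F t \<le> F (2 ^ 1 * t)"
      using eventually_ge_at_top[of 0] by eventually_elim (use F_scale_ge[of 2] in auto)
    then show ?thesis unfolding L_def by blast
  qed
  \<comment> \<open>The \<Delta>2-condition caps the growth over \<open>2 ^ k\<close> by
    \<open>\<Delta> ^ k\<close>, whatever \<open>k\<close> is.\<close>
  have bdd: "r \<le> log 2 \<Delta>" if "r \<in> L" for r
  proof -
    from that obtain k where k: "k \<ge> 1" "\<forall>\<^sub>F t in at_top. (2 ^ k) powr r * F t \<le> F (2 ^ k * t)"
      unfolding L_def by blast
    from eventually_conj[OF k(2) eventually_gt_at_top[of 0]]
    obtain t where t: "(2 ^ k) powr r * F t \<le> F (2 ^ k * t)" "0 < t"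
      using eventually_happens'[OF trivial_limit_at_top_linorder] by blast
    have "F (2 ^ j * t) \<le> \<Delta> ^ j * F t" for j
    proof (induction j)
      case (Suc j)
      have "F (2 ^ Suc j * t) \<le> \<Delta> * F (2 ^ j * t)" using \<Delta>[of "2 ^ j * t"] t by (simp add: ac_simps)
      also have "\<dots> \<le> \<Delta> * (\<Delta> ^ j * F t)" using Suc \<open>2 \<le> \<Delta>\<close> by (intro mult_left_mono) auto
      finally show ?case by (simp add: ac_simps)
    qed simp
    from order_trans[OF t(1) this[of k]] have "(2 ^ k) powr r \<le> \<Delta> ^ k"
      using F_pos[OF t(2)] by simp
    then have "log 2 ((2 ^ k) powr r) \<le> log 2 (\<Delta> ^ k)" using \<open>2 \<le> \<Delta>\<close> by (subst log_le_cancel_iff) auto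
    then have "r * real k \<le> log 2 \<Delta> * real k" using \<open>2 \<le> \<Delta>\<close> by (simp add: log_powr log_nat_power ac_simps)
    then show ?thesis using k by simp
  qed
  have bdd': "bdd_above L" using bdd by (auto simp: bdd_above_def)
  show ?thesis
  proof (rule that[of "Sup L"])
    show "1 \<le> Sup L" by (rule cSup_upper[OF 1 bdd'])
  next
    fix \<delta> :: real assume \<delta>: "0 < \<delta>"
    have "\<exists>r\<in>L. Sup L - \<delta> < r" using \<delta> 1 bdd' less_cSup_iff[of L "Sup L - \<delta>"] by auto
    then obtain r where r: "r \<in> L" "Sup L - \<delta> < r" by blast
    then obtain k where k: "k \<ge> 1" "\<forall>\<^sub>F t in at_top. (2 ^ k) powr r * F t \<le> F (2 ^ k * t)"
      unfolding L_def by blast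
    from k(2) eventually_ge_at_top[of 0]
    have "\<forall>\<^sub>F t in at_top. (2 ^ k) powr (Sup L - \<delta>) * F t \<le> F (2 ^ k * t)"
    proof eventually_elim
      case (elim t)
      have "(2 ^ k) powr (Sup L - \<delta>) * F t \<le> (2 ^ k) powr r * F t"
        using r(2) F_nonneg elim by (intro mult_right_mono powr_mono) auto
      with elim show ?case by simp
    qed
    with k(1) show "\<exists>k\<ge>1. \<forall>\<^sub>F t in at_top. (2 ^ k) powr (Sup L - \<delta>) * F t \<le> F (2 ^ k * t)" by blast
  next
    fix \<delta> :: real assume \<delta>: "0 < \<delta>"
    then have "1 < 2 powr (\<delta> / 2)" by simp
    \<comment> \<open>This \<open>k\<close> lets the spare half \<open>\<delta> / 2\<close> of the
      exponent absorb \<open>K\<close>, which is possible because \<open>K\<close> was fixed before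
      \<open>k\<close>.\<close>
    from real_arch_pow[OF this] obtain k where k: "K < (2 powr (\<delta> / 2)) ^ k" by blast
    with \<open>1 \<le> K\<close> have "k \<noteq> 0" by (intro notI) simp
    have "Sup L + \<delta> / 2 \<notin> L" using cSup_upper[OF _ bdd', of "Sup L + \<delta> / 2"] \<delta> by auto
    with \<open>k \<noteq> 0\<close> have "\<not> (\<forall>\<^sub>F t in at_top. (2 ^ k) powr (Sup L + \<delta> / 2) * F t \<le> F (2 ^ k * t))"
      unfolding L_def by auto
    then have "\<exists>\<^sub>F t in at_top. F (2 ^ k * t) < (2 ^ k) powr (Sup L + \<delta> / 2) * F t"
      by (simp add: frequently_def not_less)
    then have "\<forall>\<^sub>F t in at_top. F (2 ^ k * t) \<le> K * (2 ^ k) powr (Sup L + \<delta> / 2) * F t"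
      by (intro K) auto
    then have "\<forall>\<^sub>F t in at_top. F (2 ^ k * t) \<le> (2 ^ k) powr (Sup L + \<delta>) * F t"
      using eventually_ge_at_top[of 0]
    proof eventually_elim
      case (elim t)
      have "K * (2 ^ k) powr (Sup L + \<delta> / 2) \<le> (2 powr (\<delta> / 2)) ^ k * (2 ^ k) powr (Sup L + \<delta> / 2)"
        using k by (intro mult_right_mono) auto
      also have "\<dots> = (2 ^ k) powr (\<delta> / 2) * (2 ^ k) powr (Sup L + \<delta> / 2)"
        by (simp add: powr_realpow[symmetric] powr_powr mult.commute)
      also have "\<dots> = (2 ^ k) powr (Sup L + \<delta>)" by (simp add: powr_add[symmetric] add.commute)
      finally have "K * (2 ^ k) powr (Sup L + \<delta> / 2) * F t \<le> (2 ^ k) powr (Sup L + \<delta>) * F t"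
        using F_nonneg elim by (intro mult_right_mono) auto
      with elim show ?case by simp
    qed
    with \<open>k \<noteq> 0\<close> show "\<exists>k\<ge>1. \<forall>\<^sub>F t in at_top. F (2 ^ k * t) \<le> (2 ^ k) powr (Sup L + \<delta>) * F t"
      by (intro exI[of _ k]) auto
  qed
qed

text \<open>Extends the estimates from powers of \<open>2 ^ k\<close> to all
  \<open>A \<ge> 1\<close> at the cost of a constant. The condition \<open>\<delta> < p\<close>
  keeps the lower exponent positive.\<close>

lemma growth_bounds:
  assumes rsp: "right_shift_property (dyadic_space F) (dyadic_norm F)" and delta2: "delta2_condition F"
  obtains p :: real where "1 \<le> p"
    and "\<And>\<delta>. 0 < \<delta> \<Longrightarrow> \<delta> < p \<Longrightarrow> \<exists>C\<ge>1. \<exists>t0>0. \<forall>t\<ge>t0. \<forall>A\<ge>1.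
      A powr (p - \<delta>) * F t \<le> C * F (A * t) \<and> F (A * t) \<le> C * A powr (p + \<delta>) * F t"
proof -
  obtain p where "1 \<le> p"
    and lower: "\<And>\<delta>. 0 < \<delta> \<Longrightarrow> \<exists>k\<ge>1. \<forall>\<^sub>F t in at_top. (2 ^ k) powr (p - \<delta>) * F t \<le> F (2 ^ k * t)"
    and upper: "\<And>\<delta>. 0 < \<delta> \<Longrightarrow> \<exists>k\<ge>1. \<forall>\<^sub>F t in at_top. F (2 ^ k * t) \<le> (2 ^ k) powr (p + \<delta>) * F t"
    using growth_exponent[OF rsp delta2] by blast
  show ?thesis
  proof (rule that[OF \<open>1 \<le> p\<close>])
    fix \<delta> :: real assume \<delta>: "0 < \<delta>" "\<delta> < p"
    from lower[OF \<delta>(1)] obtain k T where k: "1 \<le> k"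
      and T: "\<And>t. T \<le> t \<Longrightarrow> (2 ^ k) powr (p - \<delta>) * F t \<le> F (2 ^ k * t)"
      unfolding eventually_at_top_linorder by blast
    from upper[OF \<delta>(1)] obtain j S where j: "1 \<le> j"
      and S: "\<And>t. S \<le> t \<Longrightarrow> F (2 ^ j * t) \<le> (2 ^ j) powr (p + \<delta>) * F t"
      unfolding eventually_at_top_linorder by blast
    define t0 where "t0 = max 1 (max S T)"
    define C where "C = max ((2 ^ k) powr (p - \<delta>)) ((2 ^ j) powr (p + \<delta>))"
    have "1 \<le> (2 ^ j) powr (p + \<delta>)" using \<delta> by (intro ge_one_powr_ge_zero) auto
    then have "1 \<le> C" by (simp add: C_def)
    moreover have "A powr (p - \<delta>) * F t \<le> C * F (A * t) \<and> F (A * t) \<le> C * A powr (p + \<delta>) * F t"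
      if t: "t0 \<le> t" and A: "1 \<le> A" for t A
    proof
      have "A powr (p - \<delta>) * F t \<le> (2 ^ k) powr (p - \<delta>) * F (A * t)"
        using k \<delta> T t A by (intro growth_lower[of t0]) (auto simp: t0_def)
      also have "\<dots> \<le> C * F (A * t)"
        using t A F_nonneg by (intro mult_right_mono) (auto simp: C_def t0_def)
      finally show "A powr (p - \<delta>) * F t \<le> C * F (A * t)" .
      have "F (A * t) \<le> (2 ^ j) powr (p + \<delta>) * A powr (p + \<delta>) * F t"
        using j \<delta> S t A by (intro growth_upper[of t0]) (auto simp: t0_def)
      also have "\<dots> \<le> C * A powr (p + \<delta>) * F t"
        using t A F_nonneg by (intro mult_right_mono) (auto simp: C_def t0_def)
      finally show "F (A * t) \<le> C * A powr (p + \<delta>) * F t" .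
    qed
    ultimately show "\<exists>C\<ge>1. \<exists>t0>0. \<forall>t\<ge>t0. \<forall>A\<ge>1.
      A powr (p - \<delta>) * F t \<le> C * F (A * t) \<and> F (A * t) \<le> C * A powr (p + \<delta>) * F t"
      by (intro exI[of _ C] conjI exI[of _ t0]) (auto simp: t0_def)
  qed
qed

end

section \<open>From growth of \<open>F\<close> to the size of dilation norms\<close>

context orlicz
begin

text \<open>Upper bounds solve for an \<open>A\<close> with \<open>a * F v \<le> F (A * v)\<close>;
  lower bounds use two points whose \<open>F\<close>-values have ratio \<open>a\<close>. For
  \<open>a \<le> 1\<close> the growth is read backwards, so \<open>r\<close> and \<open>q\<close>
  exchange places.\<close>

lemma dilation_norm_bounds:
  assumes "0 < r" "r \<le> q" "1 \<le> C" "0 < t0"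
    and lower: "\<And>t A. t0 \<le> t \<Longrightarrow> 1 \<le> A \<Longrightarrow> A powr r * F t \<le> C * F (A * t)"
    and upper: "\<And>t A. t0 \<le> t \<Longrightarrow> 1 \<le> A \<Longrightarrow> F (A * t) \<le> C * A powr q * F t"
  shows "1 \<le> a \<Longrightarrow> dilation_norm F a \<in> {(a / C) powr (1 / q)..(C * a) powr (1 / r) * (1 + F t0)}"
    and "0 < a \<Longrightarrow> a \<le> 1 \<Longrightarrow>
      dilation_norm F a \<in> {(a / C) powr (1 / r)..(C * a) powr (1 / q) * (1 + F t0)}"
proof -
  have "0 < q" using assms by linarith
  obtain u where u: "0 < u" "F u = 1" using F_surj_pos[of 1] by auto
  \<comment> \<open>Beyond \<open>t0\<close> the growth estimates hold, and beyond \<open>u\<close>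
    the test segments of \<open>dilation_norm_lower\<close> fit into \<open>{0..1}\<close>.\<close>
  define w where "w = max t0 u"
  have w: "t0 \<le> w" "0 < w" using u by (auto simp: w_def)
  have Fw: "1 \<le> F w" using u F_le_iff[of u w] by (auto simp: w_def)
  have ratio: "\<exists>A\<ge>1. F (A * w) = c * F w" if c: "1 \<le> c" for c
  proof -
    obtain v where v: "0 < v" "F v = c * F w" using F_surj_pos[of "c * F w"] c Fw by auto
    have "F w \<le> F v" using v c Fw by simp
    then have "w \<le> v" using F_le_iff[of w v] v w by simp
    then show ?thesis using v w by (intro exI[of _ "v / w"]) auto
  qed
  show "dilation_norm F a \<in> {(a / C) powr (1 / q)..(C * a) powr (1 / r) * (1 + F t0)}" if a: "1 \<le> a"
  proof -
    define A where "A = (C * a) powr (1 / r)"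
    have Ca: "1 \<le> C * a" using mult_mono[of 1 C 1 a] assms a by simp
    have A: "1 \<le> A" unfolding A_def using Ca assms(1) by (intro ge_one_powr_ge_zero) auto
    have "A powr r = C * a" using assms(1) Ca by (simp add: A_def powr_powr)
    then have "a * F v \<le> F (A * v)" if "t0 \<le> v" for v
      using lower[OF that A] assms(3) by (simp add: mult.assoc)
    then have "dilation_norm F a \<le> A * (1 + F t0)"
      using a A assms by (intro dilation_norm_upper) auto
    moreover have "(a / C) powr (1 / q) \<le> dilation_norm F a"
    proof -
      obtain B where B: "1 \<le> B" "F (B * w) = a * F w" using ratio[OF a] by blast
      have "a * F w \<le> C * B powr q * F w" using upper[OF w(1) B(1)] B by simp
      then have "a \<le> C * B powr q" using Fw by simp
      then have "a / C \<le> B powr q" using assms(3) by (simp add: field_simps)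
      then have "(a / C) powr (1 / q) \<le> (B powr q) powr (1 / q)"
        using a assms(3) \<open>0 < q\<close> by (intro powr_mono2) auto
      also have "\<dots> = B * w / w" using B w \<open>0 < q\<close> by (simp add: powr_powr)
      also have "\<dots> \<le> dilation_norm F a"
        using a B w Fw mult_mono[of 1 a 1 "F w"] by (intro dilation_norm_lower) auto
      finally show ?thesis .
    qed
    ultimately show ?thesis by (simp add: A_def)
  qed
  show "dilation_norm F a \<in> {(a / C) powr (1 / r)..(C * a) powr (1 / q) * (1 + F t0)}"
    if a: "0 < a" "a \<le> 1"
  proof -
    define A where "A = (C * a) powr (1 / q)"
    have A: "0 < A" using a assms(3) by (simp add: A_def)
    have Aq: "A powr q = C * a" using a assms(3) \<open>0 < q\<close> by (simp add: A_def powr_powr)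
    have "a * F v \<le> F (A * v)" if v: "t0 \<le> v" "t0 \<le> A * v" for v
    \<comment> \<open>As \<open>C * a\<close> may exceed 1, so may \<open>A\<close>; then
      monotonicity suffices. Otherwise \<open>upper\<close> is applied at \<open>A * v\<close> with
      factor \<open>1 / A\<close>.\<close>
    proof (cases "1 \<le> A")
      case True
      have "a * F v \<le> 1 * F v" using a v assms(4) F_nonneg by (intro mult_right_mono) auto
      also have "F v \<le> F (A * v)" using True v assms(4) mult_right_mono[of 1 A v] by (subst F_le_iff) auto
      finally show ?thesis by simp
    next
      case False
      have "F ((1 / A) * (A * v)) \<le> C * (1 / A) powr q * F (A * v)"
        using False A by (intro upper v) auto
      also have "\<dots> = F (A * v) / a" using a A assms(3) by (simp add: powr_divide Aq)
      finally show ?thesis using A a by (simp add: field_simps)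
    qed
    then have "dilation_norm F a \<le> A * (1 + F t0)"
      using a A assms by (intro dilation_norm_upper) auto
    moreover have "(a / C) powr (1 / r) \<le> dilation_norm F a"
    proof -
      have "1 \<le> 1 / a" using a by simp
      from ratio[OF this] obtain B where B: "1 \<le> B" "F (B * w) = 1 / a * F w" by blast
      have "B powr r * F w \<le> C / a * F w" using lower[OF w(1) B(1)] B by simp
      then have "B powr r \<le> C / a" using Fw by (subst (asm) mult_le_cancel_right_pos) auto
      then have "(B powr r) powr (1 / r) \<le> (C / a) powr (1 / r)"
        using assms(1) by (intro powr_mono2) auto
      then have "B \<le> (C / a) powr (1 / r)" using B assms(1) by (simp add: powr_powr)
      moreover have "(a / C) powr (1 / r) = 1 / (C / a) powr (1 / r)"
        using a assms(3) by (simp add: powr_divide)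
      ultimately have "(a / C) powr (1 / r) \<le> 1 / B" using B by (simp add: frac_le)
      also have "\<dots> = w / (B * w)" using w by simp
      also have "\<dots> \<le> dilation_norm F a"
      proof (intro dilation_norm_lower)
        show "1 \<le> F (B * w)" using B Fw a F_le_iff[of w "B * w"] w mult_right_mono[of 1 B w] by simp
        show "F w = a * F (B * w)" using B(2) a by simp
      qed (use a B w Fw in auto)
      finally show ?thesis .
    qed
    ultimately show ?thesis by (simp add: A_def)
  qed
qed

end

subsection \<open>Boyd indices\<close>

lemma tendsto_affine_quotient:
  fixes g :: "'a \<Rightarrow> real"
  assumes "filterlim g at_infinity Fl"
  shows "((\<lambda>x. (\<alpha> + \<beta> * g x) / g x) \<longlongrightarrow> \<beta>) Fl"
proof -
  have "((\<lambda>x. \<alpha> * inverse (g x) + \<beta>) \<longlongrightarrow> \<alpha> * 0 + \<beta>) Fl"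
    by (intro tendsto_intros filterlim_compose[OF tendsto_inverse_0 assms])
  moreover have "\<forall>\<^sub>F x in Fl. \<alpha> * inverse (g x) + \<beta> = (\<alpha> + \<beta> * g x) / g x"
  proof -
    have "\<forall>\<^sub>F x in Fl. g x \<noteq> 0"
      using filterlim_at_infinity_imp_eventually_ne[OF assms, of 0] .
    then show ?thesis by eventually_elim (simp add: field_simps)
  qed
  ultimately show ?thesis by (simp add: Lim_transform_eventually)
qed

text \<open>The bounding functions may depend on \<open>\<delta>\<close>, as the growth constants
  do: a suitable \<open>\<delta>\<close> is fixed for each level \<open>y\<close> before the limit
  is taken.\<close>

lemma tendsto_inverse_sandwich:
  fixes p :: real and g :: "'a \<Rightarrow> real"
  assumes p: "0 < p"
    and bounds: "\<And>\<delta>. 0 < \<delta> \<Longrightarrow> \<delta> < p \<Longrightarrow> \<exists>l u. (l \<longlongrightarrow> 1 / (p + \<delta>)) Fl \<and> (u \<longlongrightarrow> 1 / (p - \<delta>)) Fl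
      \<and> (\<forall>\<^sub>F x in Fl. l x \<le> g x \<and> g x \<le> u x)"
  shows "(g \<longlongrightarrow> 1 / p) Fl"
proof (rule order_tendstoI)
  have lim: "((\<lambda>\<delta>. 1 / (p + \<delta>)) \<longlongrightarrow> 1 / (p + 0)) (at_right 0)" "((\<lambda>\<delta>. 1 / (p - \<delta>)) \<longlongrightarrow> 1 / (p - 0)) (at_right 0)"
    using p by (intro tendsto_intros; simp)+
  have small: "\<forall>\<^sub>F \<delta> in at_right 0. 0 < \<delta> \<and> \<delta> < p"
    using p eventually_at_right_real[of 0 p] by simp
  fix y
  show "\<forall>\<^sub>F x in Fl. y < g x" if "y < 1 / p"
  proof -
    have "\<forall>\<^sub>F \<delta> in at_right 0. y < 1 / (p + \<delta>)" using order_tendstoD(1)[OF lim(1), of y] that by simp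
    from eventually_happens[OF eventually_conj[OF this small]] obtain \<delta>
      where \<delta>: "y < 1 / (p + \<delta>)" "0 < \<delta>" "\<delta> < p" by auto
    from bounds[OF \<delta>(2,3)] obtain l where l: "(l \<longlongrightarrow> 1 / (p + \<delta>)) Fl" "\<forall>\<^sub>F x in Fl. l x \<le> g x"
      by (auto simp: eventually_conj_iff)
    from order_tendstoD(1)[OF l(1) \<delta>(1)] l(2) show ?thesis by eventually_elim simp
  qed
  show "\<forall>\<^sub>F x in Fl. g x < y" if "1 / p < y"
  proof -
    have "\<forall>\<^sub>F \<delta> in at_right 0. 1 / (p - \<delta>) < y" using order_tendstoD(2)[OF lim(2), of y] that by simp
    from eventually_happens[OF eventually_conj[OF this small]] obtain \<delta>
      where \<delta>: "1 / (p - \<delta>) < y" "0 < \<delta>" "\<delta> < p" by auto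
    from bounds[OF \<delta>(2,3)] obtain u where u: "(u \<longlongrightarrow> 1 / (p - \<delta>)) Fl" "\<forall>\<^sub>F x in Fl. g x \<le> u x"
      by (auto simp: eventually_conj_iff)
    from order_tendstoD(2)[OF u(1) \<delta>(1)] u(2) show ?thesis by eventually_elim simp
  qed
qed

text \<open>Taking logarithms is legitimate because the positive lower bound forces
  \<open>0 < D\<close>.\<close>

lemma ln_sandwich:
  fixes D :: real
  assumes "D \<in> {(a / C) powr x..(C * a) powr y * M}" "0 < a" "0 < C" "0 < M"
  shows "ln D \<in> {- x * ln C + x * ln a..(ln M + y * ln C) + y * ln a}"
proof -
  have "0 < (a / C) powr x" using assms by simp
  with assms(1) have "0 < D" unfolding atLeastAtMost_iff by linarith
  with assms \<open>0 < (a / C) powr x\<close> have "0 < (C * a) powr y * M"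
      "ln ((a / C) powr x) \<le> ln D" "ln D \<le> ln ((C * a) powr y * M)"
    unfolding atLeastAtMost_iff by (simp, metis ln_le_cancel_iff, metis ln_le_cancel_iff order_less_le_trans)
  then show ?thesis using assms by (simp add: ln_powr ln_mult ln_div algebra_simps)
qed

theorem proposition6p8:
  fixes F :: "real \<Rightarrow> real"
  assumes "orlicz_function F"
    and "delta2_condition F"
    and "elastic F"
  shows "\<exists>p q. has_lower_boyd_index F p \<and> has_upper_boyd_index F q \<and> p = q"
proof -
  interpret orlicz F using assms(1) by unfold_locales
  have "\<forall>n. \<exists>b>0. F b = 2 powi (- n)" by (intro allI F_surj_pos) simp
  then obtain b :: "int \<Rightarrow> real" where b: "\<And>n. 0 < b n" "\<And>n. F (b n) = 2 powi (- n)" by metis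
  interpret orlicz_basis F b using b by unfold_locales auto
  have rsp: "right_shift_property (dyadic_space F) (dyadic_norm F)"
    using assms(3) by (simp add: elastic_def)
  obtain p :: real where "1 \<le> p"
    and bounds: "\<And>\<delta>. 0 < \<delta> \<Longrightarrow> \<delta> < p \<Longrightarrow> \<exists>C\<ge>1. \<exists>t0>0. \<forall>t\<ge>t0. \<forall>A\<ge>1.
      A powr (p - \<delta>) * F t \<le> C * F (A * t) \<and> F (A * t) \<le> C * A powr (p + \<delta>) * F t"
    using growth_bounds[OF rsp assms(2)] by blast
  have dil: "\<exists>C>0. \<exists>M>0. (\<forall>a\<ge>1. dilation_norm F a \<in> {(a / C) powr (1 / (p + \<delta>))..(C * a) powr (1 / (p - \<delta>)) * M})
    \<and> (\<forall>a. 0 < a \<and> a \<le> 1 \<longrightarrow> dilation_norm F a \<in> {(a / C) powr (1 / (p - \<delta>))..(C * a) powr (1 / (p + \<delta>)) * M})"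
    if \<delta>: "0 < \<delta>" "\<delta> < p" for \<delta>
  proof -
    from bounds[OF \<delta>] obtain C t0 where C: "1 \<le> C" and t0: "0 < t0"
      and est: "\<And>t A. t0 \<le> t \<Longrightarrow> 1 \<le> A \<Longrightarrow> A powr (p - \<delta>) * F t \<le> C * F (A * t)"
        "\<And>t A. t0 \<le> t \<Longrightarrow> 1 \<le> A \<Longrightarrow> F (A * t) \<le> C * A powr (p + \<delta>) * F t" by blast
    have "0 < p - \<delta>" "p - \<delta> \<le> p + \<delta>" using \<delta> by auto
    note D = dilation_norm_bounds[OF this C t0 est]
    show ?thesis
      using C D F_nonneg[of t0] t0 by (intro exI[of _ C] exI[of _ "1 + F t0"] conjI) auto
  qed
  \<comment> \<open>The reciprocal of the Boyd quotient is treated first, because its bounds are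
    affine in \<open>ln a\<close> divided by \<open>ln a\<close>; inverting the limit is safe as
    \<open>p \<ge> 1\<close>.\<close>
  have "((\<lambda>a. ln (dilation_norm F a) / ln a) \<longlongrightarrow> 1 / p) at_top"
  proof (rule tendsto_inverse_sandwich)
    fix \<delta> :: real assume \<delta>: "0 < \<delta>" "\<delta> < p"
    from dil[OF \<delta>] obtain C M where CM: "0 < C" "0 < M"
      and D: "\<And>a. 1 \<le> a \<Longrightarrow> dilation_norm F a \<in> {(a / C) powr (1 / (p + \<delta>))..(C * a) powr (1 / (p - \<delta>)) * M}"
      by blast
    have inf: "filterlim ln at_infinity (at_top :: real filter)"
      using ln_at_top by (rule filterlim_at_top_imp_at_infinity)
    have "\<forall>\<^sub>F a in at_top. (- (1 / (p + \<delta>)) * ln C + 1 / (p + \<delta>) * ln a) / ln a \<le> ln (dilation_norm F a) / ln a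
        \<and> ln (dilation_norm F a) / ln a \<le> ((ln M + 1 / (p - \<delta>) * ln C) + 1 / (p - \<delta>) * ln a) / ln a"
      using eventually_gt_at_top[of 1]
    proof eventually_elim
      case (elim a)
      then have "0 \<le> ln a" by simp
      then show ?case using ln_sandwich[OF D _ CM, of a] elim
        by (intro conjI divide_right_mono) auto
    qed
    with tendsto_affine_quotient[OF inf] show "\<exists>l u. (l \<longlongrightarrow> 1 / (p + \<delta>)) at_top \<and> (u \<longlongrightarrow> 1 / (p - \<delta>)) at_top
      \<and> (\<forall>\<^sub>F a in at_top. l a \<le> ln (dilation_norm F a) / ln a \<and> ln (dilation_norm F a) / ln a \<le> u a)"
      by (intro exI conjI)
  qed (use \<open>1 \<le> p\<close> in simp)
  from tendsto_inverse[OF this] \<open>1 \<le> p\<close> have "has_lower_boyd_index F p"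
    by (simp add: has_lower_boyd_index_def)
  have "((\<lambda>a. ln (dilation_norm F a) / ln a) \<longlongrightarrow> 1 / p) (at_right 0)"
  proof (rule tendsto_inverse_sandwich)
    fix \<delta> :: real assume \<delta>: "0 < \<delta>" "\<delta> < p"
    from dil[OF \<delta>] obtain C M where CM: "0 < C" "0 < M"
      and D: "\<And>a. 0 < a \<Longrightarrow> a \<le> 1 \<Longrightarrow>
        dilation_norm F a \<in> {(a / C) powr (1 / (p - \<delta>))..(C * a) powr (1 / (p + \<delta>)) * M}"
      by blast
    have inf: "filterlim ln at_infinity (at_right (0 :: real))"
      using ln_at_0 by (rule filterlim_at_bot_imp_at_infinity)
    \<comment> \<open>Here \<open>ln a < 0\<close>, so division swaps the bounds and
      \<open>1 / (p + \<delta>)\<close> is again the lower limit.\<close>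
    have "\<forall>\<^sub>F a in at_right 0. ((ln M + 1 / (p + \<delta>) * ln C) + 1 / (p + \<delta>) * ln a) / ln a \<le> ln (dilation_norm F a) / ln a
        \<and> ln (dilation_norm F a) / ln a \<le> (- (1 / (p - \<delta>)) * ln C + 1 / (p - \<delta>) * ln a) / ln a"
      using eventually_at_right_real[OF zero_less_one]
    proof eventually_elim
      case (elim a)
      then have "ln a \<le> 0" by simp
      then show ?case using ln_sandwich[OF D _ CM, of a] elim
        by (intro conjI divide_right_mono_neg) auto
    qed
    with tendsto_affine_quotient[OF inf] show "\<exists>l u. (l \<longlongrightarrow> 1 / (p + \<delta>)) (at_right 0) \<and> (u \<longlongrightarrow> 1 / (p - \<delta>)) (at_right 0)
      \<and> (\<forall>\<^sub>F a in at_right 0. l a \<le> ln (dilation_norm F a) / ln a \<and> ln (dilation_norm F a) / ln a \<le> u a)"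
      by (intro exI conjI)
  qed (use \<open>1 \<le> p\<close> in simp)
  from tendsto_inverse[OF this] \<open>1 \<le> p\<close> have "has_upper_boyd_index F p"
    by (simp add: has_upper_boyd_index_def)
  with \<open>has_lower_boyd_index F p\<close> show ?thesis by blast
qed

end
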